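(* Let $X$ be a complete L-ordered metric space and let $(A,e)$ be a $P$-algebra in $\mathsf{L\text{-}COMet}$. Then the assignments $f\mapsto e\circ Pf$ and $\tilde f\mapsto\tilde f\circ\delta$ are mutually inverse isomorphisms of partial orders $$\mathsf{L\text{-}COMet}(X,A)\cong\mathsf{L\text{-}COMet}^P(PX,A),$$ where both sides carry the pointwise order, and $A$ on the left denotes the underlying object of the algebra $A$.
   Context: An ordered metric space is a metric space $X$ with a partial order $\le$ whose graph $\{\le\}\subseteq X\times X$ is closed. A map is short if it is 1-Lipschitz. An ordered metric space $X$ is L-ordered if for all $x,y\in X$: $x\le y$ iff $f(x)\le f(y)$ for every short monotone $f:X\to\mathbb{R}$. $\mathsf{L\text{-}COMet}$ is the category of complete L-ordered metric spaces and short monotone maps. The ordered Kantorovich monad $(P,\delta,E)$ on $\mathsf{L\text{-}COMet}$: $PX$ is the set of Radon probability measures $p$ on $X$ of finite first moment ($\int f\,dp$ exists and is finite for every short $f:X\to\mathbb{R}$), with the Kantorovich–Wasserstein metric $d(p,q)=\inf_r\int d(x,y)\,dr(x,y)$ over couplings $r$ of $p,q$ (probability measures on $X\times X$ with marginals $p,q$), and the stochastic order: $p\le q$ iff some coupling of $p$ and $q$ is supported on $\{\le\}$. $Pf$ is pushforward, $\delta_X:X\to PX$ is $x\mapsto\delta_x$, and $E_X:PPX\to PX$ is averaging, $\int f\,d(E\mu)=\int_{PX}(\int_X f\,dp)\,d\mu(p)$. $\mathsf{L\text{-}COMet}^P$ is the category of Eilenberg–Moore algebras $(A,e:PA\to A)$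 and algebra morphisms (short monotone $f$ with $f\circ e=e\circ Pf$); $PX$ is regarded as the free algebra $(PX,E_X)$. Pointwise order: $f\le g$ iff $f(x)\le g(x)$ for all $x$. *)

theory Defs
  imports "HOL-Probability.Probability"
begin

section \<open>Complete L-ordered metric spaces\<close>

text \<open>
  Objects are carrier-based, because the Kantorovich construction has to be iterated and its
  points form a set of measures rather than a whole type. The field \<open>leq\<close> is the graph of
  the order.
\<close>

record 'a omet =
  pts :: "'a set"
  dst :: "'a \<Rightarrow> 'a \<Rightarrow> real"
  leq :: "('a \<times> 'a) set"

definition top_of :: "'a omet \<Rightarrow> 'a topology" where
  "top_of X = Metric_space.mtopology (pts X) (dst X)"

definition ordered_metric_space :: "'a omet \<Rightarrow> bool" where
  "ordered_metric_space X \<longleftrightarrow>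
     Metric_space (pts X) (dst X) \<and>
     partial_order_on (pts X) (leq X) \<and>
     closedin (prod_topology (top_of X) (top_of X)) (leq X)"

definition short_map :: "'a omet \<Rightarrow> 'b omet \<Rightarrow> ('a \<Rightarrow> 'b) \<Rightarrow> bool" where
  "short_map X Y f \<longleftrightarrow>
     f \<in> pts X \<rightarrow> pts Y \<and>
     (\<forall>x\<in>pts X. \<forall>y\<in>pts X. dst Y (f x) (f y) \<le> dst X x y)"

definition monotone_map :: "'a omet \<Rightarrow> 'b omet \<Rightarrow> ('a \<Rightarrow> 'b) \<Rightarrow> bool" where
  "monotone_map X Y f \<longleftrightarrow> (\<forall>(x, y)\<in>leq X. (f x, f y) \<in> leq Y)"

definition real_line :: "real omet" where
  "real_line = \<lparr>pts = UNIV, dst = dist, leq = {(x, y). x \<le> y}\<rparr>"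

definition L_ordered :: "'a omet \<Rightarrow> bool" where
  "L_ordered X \<longleftrightarrow>
     (\<forall>x\<in>pts X. \<forall>y\<in>pts X. (x, y) \<in> leq X \<longleftrightarrow>
        (\<forall>f. short_map X real_line f \<and> monotone_map X real_line f \<longrightarrow> f x \<le> f y))"

definition L_COMet :: "'a omet \<Rightarrow> bool" where
  "L_COMet X \<longleftrightarrow>
     ordered_metric_space X \<and> Metric_space.mcomplete (pts X) (dst X) \<and> L_ordered X"

text \<open>
  Morphisms are taken extensional (\<open>undefined\<close> off the carrier), so that equality of
  HOL functions is equality of morphisms.
\<close>

definition L_COMet_hom :: "'a omet \<Rightarrow> 'b omet \<Rightarrow> ('a \<Rightarrow> 'b) set" where
  "L_COMet_hom X Y = {f \<in> pts X \<rightarrow>\<^sub>E pts Y. short_map X Y f \<and> monotone_map X Y f}"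


section \<open>The ordered Kantorovich monad\<close>

definition borel_on :: "'a topology \<Rightarrow> 'a measure" where
  "borel_on T = sigma (topspace T) {U. openin T U}"

abbreviation borel_of_omet :: "'a omet \<Rightarrow> 'a measure" where
  "borel_of_omet X \<equiv> borel_on (top_of X)"

text \<open>
  For a finite Borel measure on a metric space, being Radon amounts to inner regularity with
  respect to compact sets.
\<close>

definition radon_prob :: "'a omet \<Rightarrow> 'a measure \<Rightarrow> bool" where
  "radon_prob X p \<longleftrightarrow>
     prob_space p \<and> space p = pts X \<and> sets p = sets (borel_of_omet X) \<and>
     (\<forall>B\<in>sets p. emeasure p B = (SUP K\<in>{K. compactin (top_of X) K \<and> K \<subseteq> B}. emeasure p K))"

definition finite_first_moment :: "'a omet \<Rightarrow> 'a measure \<Rightarrow> bool" where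
  "finite_first_moment X p \<longleftrightarrow> (\<forall>f. short_map X real_line f \<longrightarrow> integrable p f)"

text \<open>
  Couplings live on the Borel sigma-algebra of the product topology, which for non-separable
  \<open>X\<close> can be strictly larger than the product sigma-algebra; this makes both the metric and the
  closed set \<open>leq X\<close> measurable. A coupling of Radon measures is automatically Radon.
\<close>

definition couplings :: "'a omet \<Rightarrow> 'a measure \<Rightarrow> 'a measure \<Rightarrow> ('a \<times> 'a) measure set" where
  "couplings X p q =
     {r. prob_space r \<and>
         space r = pts X \<times> pts X \<and>
         sets r = sets (borel_on (prod_topology (top_of X) (top_of X))) \<and>
         distr r (borel_of_omet X) fst = p \<and>
         distr r (borel_of_omet X) snd = q}"

definition P_pts :: "'a omet \<Rightarrow> 'a measure set" where
  "P_pts X = {p. radon_prob X p \<and> finite_first_moment X p}"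

text \<open>
  The value 0 off the carrier is only a totalization: the locale \<open>Metric_space\<close> demands
  nonnegativity and symmetry on the whole type. For \<open>p, q\<close> in \<open>P_pts X\<close> the metric is
  integrable against every coupling, so the Bochner integral is the genuine one.
\<close>

definition P_dst :: "'a omet \<Rightarrow> 'a measure \<Rightarrow> 'a measure \<Rightarrow> real" where
  "P_dst X p q =
     (if p \<in> P_pts X \<and> q \<in> P_pts X
      then (INF r\<in>couplings X p q. \<integral>z. dst X (fst z) (snd z) \<partial>r)
      else 0)"

definition P_leq :: "'a omet \<Rightarrow> ('a measure \<times> 'a measure) set" where
  "P_leq X =
     {(p, q). p \<in> P_pts X \<and> q \<in> P_pts X \<and> (\<exists>r\<in>couplings X p q. measure r (leq X) = 1)}"

definition P_obj :: "'a omet \<Rightarrow> 'a measure omet" where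
  "P_obj X = \<lparr>pts = P_pts X, dst = P_dst X, leq = P_leq X\<rparr>"

definition P_map :: "'a omet \<Rightarrow> 'b omet \<Rightarrow> ('a \<Rightarrow> 'b) \<Rightarrow> 'a measure \<Rightarrow> 'b measure" where
  "P_map X Y f = (\<lambda>p\<in>pts (P_obj X). distr p (borel_of_omet Y) f)"

definition P_unit :: "'a omet \<Rightarrow> 'a \<Rightarrow> 'a measure" where
  "P_unit X = (\<lambda>x\<in>pts X. return (borel_of_omet X) x)"

text \<open>
  The description is proper: Radon probability measures are separated by short real functions.
\<close>

definition P_avg :: "'a omet \<Rightarrow> 'a measure measure \<Rightarrow> 'a measure" where
  "P_avg X = (\<lambda>\<mu>\<in>pts (P_obj (P_obj X)).
     (THE q. q \<in> pts (P_obj X) \<and>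
        (\<forall>f. short_map X real_line f \<longrightarrow>
           (\<integral>x. f x \<partial>q) = (\<integral>p. (\<integral>x. f x \<partial>p) \<partial>\<mu>))))"


section \<open>Eilenberg--Moore algebras\<close>

definition P_algebra :: "'a omet \<Rightarrow> ('a measure \<Rightarrow> 'a) \<Rightarrow> bool" where
  "P_algebra A e \<longleftrightarrow>
     L_COMet A \<and>
     e \<in> L_COMet_hom (P_obj A) A \<and>
     (\<forall>a\<in>pts A. e (P_unit A a) = a) \<and>
     (\<forall>\<mu>\<in>pts (P_obj (P_obj A)). e (P_avg A \<mu>) = e (P_map (P_obj A) A e \<mu>))"

definition P_algebra_hom ::
    "'b omet \<Rightarrow> ('b measure \<Rightarrow> 'b) \<Rightarrow> 'a omet \<Rightarrow> ('a measure \<Rightarrow> 'a) \<Rightarrow> ('b \<Rightarrow> 'a) set" where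
  "P_algebra_hom B b A a =
     {f \<in> L_COMet_hom B A. \<forall>p\<in>pts (P_obj B). f (b p) = a (P_map B A f p)}"


section \<open>Posets of morphisms\<close>

definition pointwise_order ::
    "'b omet \<Rightarrow> 'a omet \<Rightarrow> ('b \<Rightarrow> 'a) set \<Rightarrow> (('b \<Rightarrow> 'a) \<times> ('b \<Rightarrow> 'a)) set" where
  "pointwise_order B A F = {(f, g). f \<in> F \<and> g \<in> F \<and> (\<forall>x\<in>pts B. (f x, g x) \<in> leq A)}"

definition inverse_order_isos ::
    "'f set \<Rightarrow> ('f \<times> 'f) set \<Rightarrow> 'g set \<Rightarrow> ('g \<times> 'g) set \<Rightarrow> ('f \<Rightarrow> 'g) \<Rightarrow> ('g \<Rightarrow> 'f) \<Rightarrow> bool" where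
  "inverse_order_isos F r G s \<phi> \<psi> \<longleftrightarrow>
     partial_order_on F r \<and> partial_order_on G s \<and>
     \<phi> \<in> F \<rightarrow> G \<and> \<psi> \<in> G \<rightarrow> F \<and>
     (\<forall>f\<in>F. \<psi> (\<phi> f) = f) \<and> (\<forall>g\<in>G. \<phi> (\<psi> g) = g) \<and>
     (\<forall>f\<in>F. \<forall>f'\<in>F. (f, f') \<in> r \<longleftrightarrow> (\<phi> f, \<phi> f') \<in> s) \<and>
     (\<forall>g\<in>G. \<forall>g'\<in>G. (g, g') \<in> s \<longleftrightarrow> (\<psi> g, \<psi> g') \<in> r)"

end

(*
Write \<Phi> f = e o Pf and \<Psi> g = g o \<delta>. Naturality of E and associativity of e give
\<Phi> f o E = e o E o PPf = e o Pe o PPf = e o P(\<Phi> f); the unit laws e o \<delta> = id and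
E o P\<delta> = id give \<Psi> (\<Phi> f) = f and, for an algebra morphism g,
\<Phi> (\<Psi> g) = e o Pg o P\<delta> = g o E o P\<delta> = g. For the order, f \<le> f' pointwise makes (f, f')_* p
a coupling of Pf p and Pf' p carried by the order of A.

The substance is that P, \<delta> and E are well defined.
A Radon measure is carried by the set of points approximable from some countable set, and on the
square of that set the Borel sets of the product topology lie in the product sigma-algebra; so any
probability measure on the product sigma-algebra with Radon marginals extends to a coupling.
The triangle inequality for P X follows by gluing two couplings along a countable partition of the
middle space into cells of small diameter, which needs no disintegration.
For \<mu> in PPX, integrals of short functions are short in p, which yields measurability of p \<mapsto> p(B)
and, by covering a compact subset of PX, finite nets of almost full measure for E \<mu>; in a complete
space this makes E \<mu> Radon.
*)
theory Submission
  imports Defs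
begin

section \<open>Borel sets and short maps\<close>

text \<open>Nothing assumes separability, so two sigma-algebras on the square compete: the Borel
  sets of the product topology, where couplings, the metric and the order live, and the product
  sigma-algebra, where product and glued measures live. Passing from the second to the first is the
  recurring obstacle. Short functions are the only test functions. Distances in
  \<open>P_obj X\<close> are bounded above by exhibiting a coupling and below by integrating a short
  function. A measure is determined by its short integrals, so the laws of the monad that are used
  become changes of variables. The definite description in \<open>P_avg\<close> is evaluated by
  exhibiting one measure with the right integrals. The candidate is a bind, whose integrals are easy
  and whose regularity is the hard part; completeness enters there, turning total boundedness into
  compactness.\<close>

lemma space_borel_on [simp]: "space (borel_on T) = topspace T"
  by (simp add: borel_on_def space_measure_of_conv)

lemma sets_borel_on: "sets (borel_on T) = sigma_sets (topspace T) {U. openin T U}"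
  unfolding borel_on_def by (rule sets_measure_of) (auto dest: openin_subset)

lemma openin_borel_on: "openin T U \<Longrightarrow> U \<in> sets (borel_on T)"
  by (simp add: sets_borel_on)

lemma closedin_borel_on: "closedin T C \<Longrightarrow> C \<in> sets (borel_on T)"
  using sets.compl_sets[OF openin_borel_on[of T "topspace T - C"]] closedin_subset[of T C]
  by (simp add: closedin_def double_diff)

text \<open>The closed sets are a generator that is stable under intersection and whose indicators
  are limits of multiples of short functions, which suits both uniqueness of measures and
  measurability of kernels.\<close>

lemma sets_borel_on_closed: "sets (borel_on T) = sigma_sets (topspace T) {C. closedin T C}"
proof
  show "sets (borel_on T) \<subseteq> sigma_sets (topspace T) {C. closedin T C}"
    unfolding sets_borel_on
  proof (rule sigma_sets_mono, safe)
    fix U assume "openin T U"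
    then have "U = topspace T - (topspace T - U)" "closedin T (topspace T - U)"
      by (auto dest: openin_subset)
    then show "U \<in> sigma_sets (topspace T) {C. closedin T C}"
      by (metis mem_Collect_eq sigma_sets.Basic sigma_sets.Compl)
  qed
  show "sigma_sets (topspace T) {C. closedin T C} \<subseteq> sets (borel_on T)"
    using sets.sigma_sets_subset[of "{C. closedin T C}" "borel_on T"] closedin_borel_on by auto
qed

lemma borel_on_euclidean: "borel_on euclidean = borel"
  by (simp add: borel_on_def borel_def)

lemma continuous_map_measurable_borel_on:
  assumes "continuous_map T T' f"
  shows "f \<in> borel_on T \<rightarrow>\<^sub>M borel_on T'"
proof (rule measurable_sigma_sets[OF sets_borel_on])
  show "{U. openin T' U} \<subseteq> Pow (topspace T')" by (auto dest: openin_subset)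
  show "f \<in> space (borel_on T) \<rightarrow> topspace T'"
    using continuous_map_image_subset_topspace[OF assms] by auto
  fix U assume "U \<in> {U. openin T' U}"
  then have "openin T {x \<in> topspace T. f x \<in> U}"
    using assms by (auto simp: continuous_map_def)
  moreover have "f -` U \<inter> space (borel_on T) = {x \<in> topspace T. f x \<in> U}" by auto
  ultimately show "f -` U \<inter> space (borel_on T) \<in> sets (borel_on T)"
    by (simp add: openin_borel_on)
qed

lemma pts_real_line [simp]: "pts real_line = UNIV"
  and dst_real_line [simp]: "dst real_line = dist"
  by (simp_all add: real_line_def)

lemma top_of_real_line [simp]: "top_of real_line = euclidean"
  by (simp add: top_of_def mtopology_is_euclidean)

lemma short_real_iff:
  "short_map X real_line f \<longleftrightarrow> (\<forall>x\<in>pts X. \<forall>y\<in>pts X. \<bar>f x - f y\<bar> \<le> dst X x y)"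
  by (simp add: short_map_def dist_real_def)

lemma short_map_comp: "short_map X Y f \<Longrightarrow> short_map Y Z g \<Longrightarrow> short_map X Z (\<lambda>x. g (f x))"
  unfolding short_map_def Pi_iff by (meson order_trans)

lemma short_map_cong: "short_map X Y f \<Longrightarrow> (\<And>x. x \<in> pts X \<Longrightarrow> f x = g x) \<Longrightarrow> short_map X Y g"
  unfolding short_map_def by (auto simp: Pi_iff)

text \<open>Only meaningful for nonempty \<open>K\<close>: the infimum of the empty set of reals is junk.\<close>

definition set_dst :: "'a omet \<Rightarrow> 'a set \<Rightarrow> 'a \<Rightarrow> real" where
  "set_dst X K x = (INF k\<in>K. dst X x k)"

locale metric_omet =
  fixes X :: "'a omet"
  assumes metric: "Metric_space (pts X) (dst X)"
begin

sublocale Metric_space "pts X" "dst X" by (rule metric)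

lemma top_of_eq: "top_of X = mtopology" by (simp add: top_of_def)

lemma topspace_top_of [simp]: "topspace (top_of X) = pts X" by (simp add: top_of_eq)

lemma ball_borel [measurable]: "mball a r \<in> sets (borel_of_omet X)"
  by (simp add: openin_borel_on top_of_eq)

lemma bdd_below_dst: "bdd_below ((\<lambda>k. dst X x k) ` K)"
  by (rule bdd_belowI[of _ 0]) auto

lemma set_dst_le: "k \<in> K \<Longrightarrow> set_dst X K x \<le> dst X x k"
  unfolding set_dst_def by (intro cINF_lower bdd_below_dst)

lemma set_dst_nonneg: "K \<noteq> {} \<Longrightarrow> 0 \<le> set_dst X K x"
  unfolding set_dst_def by (intro cINF_greatest) auto

lemma set_dst_less_iff: "K \<noteq> {} \<Longrightarrow> set_dst X K x < c \<longleftrightarrow> (\<exists>k\<in>K. dst X x k < c)"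
  unfolding set_dst_def by (subst cINF_less_iff) (auto simp: bdd_below_dst)

lemma set_dst_short:
  assumes "K \<noteq> {}" "K \<subseteq> pts X"
  shows "short_map X real_line (set_dst X K)"
proof -
  have le: "set_dst X K x \<le> dst X x y + set_dst X K y" if "x \<in> pts X" "y \<in> pts X" for x y
  proof -
    have "set_dst X K x - dst X x y \<le> dst X y k" if "k \<in> K" for k
      using set_dst_le[OF that, of x] triangle[of x y k] \<open>x \<in> pts X\<close> \<open>y \<in> pts X\<close> that assms by auto
    then have "set_dst X K x - dst X x y \<le> set_dst X K y"
      unfolding set_dst_def[of X K y] using assms by (intro cINF_greatest) auto
    then show ?thesis by simp
  qed
  show ?thesis unfolding short_real_iff
  proof (intro ballI)
    fix x y assume "x \<in> pts X" "y \<in> pts X"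
    then show "\<bar>set_dst X K x - set_dst X K y\<bar> \<le> dst X x y"
      using le[of x y] le[of y x] commute[of x y] by linarith
  qed
qed

text \<open>Some ball around \<open>x\<close> misses \<open>C\<close>, and its radius bounds the
  distance from below. This makes truncations built from \<open>set_dst X C\<close> vanish off
  \<open>C\<close> in the limit.\<close>

lemma set_dst_pos:
  assumes "closedin (top_of X) C" "C \<noteq> {}" "x \<in> pts X - C"
  shows "0 < set_dst X C x"
proof -
  have "openin mtopology (pts X - C)" using assms by (simp add: top_of_eq closedin_def)
  then obtain r where r: "r > 0" "mball x r \<subseteq> pts X - C"
    using assms(3) unfolding openin_mtopology by blast
  have "C \<subseteq> pts X" using closedin_subset[OF assms(1)] by simp
  have "\<not> dst X x k < r" if "k \<in> C" for k
  proof
    assume "dst X x k < r"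
    then have "k \<in> mball x r" using assms(3) that \<open>C \<subseteq> pts X\<close> by auto
    with r(2) that show False by blast
  qed
  then have "\<not> (\<exists>k\<in>C. dst X x k < r)" by blast
  then show ?thesis using set_dst_less_iff[OF assms(2), of x r] r(1) by linarith
qed

lemma dst_short: "a \<in> pts X \<Longrightarrow> short_map X real_line (\<lambda>x. dst X x a)"
  unfolding short_real_iff
proof (intro ballI)
  fix x y assume "a \<in> pts X" "x \<in> pts X" "y \<in> pts X"
  then show "\<bar>dst X x a - dst X y a\<bar> \<le> dst X x y"
    using mdist_reverse_triangle[of x a y] commute[of a y] by simp
qed

lemma continuous_dst: "continuous_map (prod_topology (top_of X) (top_of X)) euclidean (\<lambda>z. dst X (fst z) (snd z))"
  using continuous_map_mdist[of "prod_topology mtopology mtopology" Self fst snd]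
  by (simp add: top_of_eq continuous_map_fst continuous_map_snd mtopology_of_def)

lemma measurable_dst [measurable]:
  "(\<lambda>z. dst X (fst z) (snd z)) \<in> borel_measurable (borel_on (prod_topology (top_of X) (top_of X)))"
  using continuous_map_measurable_borel_on[OF continuous_dst] by (simp add: borel_on_euclidean)

end

lemma short_map_continuous:
  assumes "metric_omet X" "metric_omet Y" "short_map X Y f"
  shows "continuous_map (top_of X) (top_of Y) f"
proof -
  interpret X: metric_omet X by fact
  interpret Y: metric_omet Y by fact
  show ?thesis
    unfolding X.top_of_eq Y.top_of_eq X.metric_continuous_map[OF Y.metric]
  proof (intro conjI ballI allI impI)
    show "f ` pts X \<subseteq> pts Y" using assms(3) by (auto simp: short_map_def)
    fix a and \<epsilon> :: real assume "a \<in> pts X" "\<epsilon> > 0"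
    then show "\<exists>\<delta>>0. \<forall>x. x \<in> pts X \<and> dst X a x < \<delta> \<longrightarrow> dst Y (f a) (f x) < \<epsilon>"
      using assms(3) unfolding short_map_def by (intro exI[of _ \<epsilon>]) (auto intro: order_le_less_trans[of _ "dst X _ _"])
  qed
qed

lemma metric_omet_real_line [simp]: "metric_omet real_line"
  using Met_TC.Metric_space_axioms by (simp add: metric_omet_def)

lemma short_map_measurable:
  assumes "metric_omet X" "metric_omet Y" "short_map X Y f"
  shows "f \<in> borel_of_omet X \<rightarrow>\<^sub>M borel_of_omet Y"
  by (intro continuous_map_measurable_borel_on short_map_continuous assms)

lemma (in metric_omet) short_real_measurable:
  "short_map X real_line f \<Longrightarrow> f \<in> borel_measurable (borel_of_omet X)"
  using short_map_measurable[OF metric_omet_axioms metric_omet_real_line, of f]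
  by (simp add: borel_on_euclidean)

lemma short_prod_continuous:
  assumes "metric_omet X" "metric_omet Y" "short_map X Y f" "short_map X Y g"
  shows "continuous_map (prod_topology (top_of X) (top_of X)) (prod_topology (top_of Y) (top_of Y))
    (\<lambda>z. (f (fst z), g (snd z)))"
  using continuous_map_compose[OF continuous_map_fst[of "top_of X" "top_of X"] short_map_continuous[OF assms(1-3)]]
    continuous_map_compose[OF continuous_map_snd[of "top_of X" "top_of X"] short_map_continuous[OF assms(1,2,4)]]
  by (intro continuous_map_pairedI) (simp_all add: o_def)

section \<open>Radon measures on metric spaces\<close>

context metric_omet begin

text \<open>The integrand times its factor is \<open>max 0 (1 - (n + 1) * d)\<close> with
  \<open>d\<close> the distance to \<open>C\<close>: it equals 1 on \<open>C\<close>, tends to 0 off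
  \<open>C\<close> and is bounded by 1, so dominated convergence applies. The factor stays outside
  the integral because only the unscaled truncation is short.\<close>

lemma closed_measure_limit:
  assumes p: "prob_space p" "sets p = sets (borel_of_omet X)"
    and C: "closedin (top_of X) C" "C \<noteq> {}"
  shows "(\<lambda>n. real (Suc n) * (\<integral>x. max 0 (1 / real (Suc n) - set_dst X C x) \<partial>p)) \<longlonglongrightarrow> measure p C"
proof -
  interpret prob_space p by fact
  have space_p: "space p = pts X" using sets_eq_imp_space_eq[OF p(2)] by simp
  have CX: "C \<subseteq> pts X" using closedin_subset[OF C(1)] by simp
  have [measurable]: "set_dst X C \<in> borel_measurable p"
    using short_real_measurable[OF set_dst_short[OF C(2) CX]] measurable_cong_sets[OF p(2) refl] by blast
  have [measurable]: "C \<in> sets p" using closedin_borel_on[OF C(1)] p(2) by simp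
  let ?g = "\<lambda>n x. max 0 (1 - real (Suc n) * set_dst X C x)"
  have "(\<lambda>n. \<integral>x. ?g n x \<partial>p) \<longlonglongrightarrow> (\<integral>x. indicator C x \<partial>p)"
  proof (rule integral_dominated_convergence[where w = "\<lambda>_. 1"])
    show "AE x in p. (\<lambda>n. ?g n x) \<longlonglongrightarrow> indicator C x"
    proof (rule AE_I2)
      fix x assume "x \<in> space p"
      then have x: "x \<in> pts X" by (simp add: space_p)
      show "(\<lambda>n. ?g n x) \<longlonglongrightarrow> indicator C x"
      proof (cases "x \<in> C")
        case True
        then have "set_dst X C x = 0"
          using set_dst_le[OF True, of x] set_dst_nonneg[OF C(2), of x] x by simp
        then show ?thesis using True by simp
      next
        case False
        then have pos: "0 < set_dst X C x" using set_dst_pos[OF C] x by auto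
        then obtain N where N: "1 < real N * set_dst X C x"
          using reals_Archimedean3 by blast
        have "?g n x = 0" if "n \<ge> N" for n
        proof -
          have "real N * set_dst X C x \<le> real (Suc n) * set_dst X C x"
            using that pos by (intro mult_right_mono) auto
          then show ?thesis using N by simp
        qed
        then have "eventually (\<lambda>n. ?g n x = 0) sequentially"
          unfolding eventually_sequentially by blast
        then show ?thesis using False by (simp add: tendsto_eventually)
      qed
    qed
    show "\<And>n. AE x in p. norm (?g n x) \<le> 1"
      using set_dst_nonneg[OF C(2)] by (intro AE_I2) (auto simp: mult_nonneg_nonneg)
  qed simp_all
  moreover have "(\<integral>x. ?g n x \<partial>p) = real (Suc n) * (\<integral>x. max 0 (1 / real (Suc n) - set_dst X C x) \<partial>p)" for n
  proof -
    have "?g n x = real (Suc n) * max 0 (1 / real (Suc n) - set_dst X C x)" for x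
      by (simp add: max_mult_distrib_left right_diff_distrib del: of_nat_Suc)
    then show ?thesis by simp
  qed
  ultimately show ?thesis by simp
qed

lemma short_max_diff:
  assumes "short_map X real_line f"
  shows "short_map X real_line (\<lambda>x. max a (b - f x))"
  using assms unfolding short_real_iff by (smt (verit, best))

text \<open>Only the bounded truncations of \<open>closed_measure_limit\<close> are tested, and they
  recover the mass of every closed set. This separates the points of \<open>P_obj X\<close> and
  makes the description in \<open>P_avg\<close> unique.\<close>

lemma prob_eq_if_short_integrals_eq:
  assumes p: "prob_space p" "sets p = sets (borel_of_omet X)"
    and q: "prob_space q" "sets q = sets (borel_of_omet X)"
    and eq: "\<And>f. short_map X real_line f \<Longrightarrow> (\<integral>x. f x \<partial>p) = (\<integral>x. f x \<partial>q)"
  shows "p = q"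
proof (rule measure_eqI_generator_eq[where E = "{C. closedin (top_of X) C}" and \<Omega> = "pts X" and A = "\<lambda>_. pts X"])
  interpret p: prob_space p by fact
  interpret q: prob_space q by fact
  show "Int_stable {C. closedin (top_of X) C}" by (auto simp: Int_stable_def)
  show "{C. closedin (top_of X) C} \<subseteq> Pow (pts X)" using closedin_subset[of "top_of X"] by auto
  show "sets p = sigma_sets (pts X) {C. closedin (top_of X) C}"
    "sets q = sigma_sets (pts X) {C. closedin (top_of X) C}"
    using p(2) q(2) sets_borel_on_closed[of "top_of X"] by simp_all
  show "range (\<lambda>_. pts X) \<subseteq> {C. closedin (top_of X) C}" 
    using closedin_topspace[of "top_of X"] by simp
  show "(\<Union>i::nat. pts X) = pts X" by simp
  show "\<And>i::nat. emeasure p (pts X) \<noteq> \<infinity>" by simp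
  fix C assume "C \<in> {C. closedin (top_of X) C}"
  then have C: "closedin (top_of X) C" by simp
  show "emeasure p C = emeasure q C"
  proof (cases "C = {}")
    case False
    have CX: "C \<subseteq> pts X" using closedin_subset[OF C] by simp
    have "measure p C = measure q C"
      using closed_measure_limit[OF p C False] closed_measure_limit[OF q C False]
        eq[OF short_max_diff[OF set_dst_short[OF False CX]]] by (auto intro: LIMSEQ_unique)
    then show ?thesis by (simp add: p.emeasure_eq_measure q.emeasure_eq_measure)
  qed simp
qed

text \<open>For \<open>D\<close> inside the carrier this is the closure of \<open>D\<close>, spelled
  with countably many radii so that it is visibly Borel when \<open>D\<close> is countable. It is
  the separable piece on which a Radon measure lives.\<close>

definition near :: "'a set \<Rightarrow> 'a set" where
  "near D = {x \<in> pts X. \<forall>n. \<exists>a\<in>D. x \<in> mball a (1 / real (Suc n))}"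

lemma near_borel [measurable]:
  assumes "countable D"
  shows "near D \<in> sets (borel_of_omet X)"
proof -
  have "near D = (\<Inter>n. \<Union>a\<in>D. mball a (1 / real (Suc n)))"
    by (auto simp: near_def)
  also have "\<dots> \<in> sets (borel_of_omet X)"
    using assms by (intro sets.countable_INT' sets.countable_UN') auto
  finally show ?thesis .
qed

lemma near_mono: "D \<subseteq> D' \<Longrightarrow> near D \<subseteq> near D'"
  unfolding near_def by blast

text \<open>Inner regularity applied to the whole space yields a compact set of almost full measure,
  and a compact set is totally bounded.\<close>

lemma radon_finite_net:
  assumes "radon_prob X p" "\<epsilon> > 0" "\<delta> > 0"
  obtains N where "finite N" "N \<subseteq> pts X" "measure p (\<Union>a\<in>N. mball a \<delta>) > 1 - \<epsilon>"
proof -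
  interpret prob_space p using assms(1) by (simp add: radon_prob_def)
  have sp: "space p = pts X" and sets_p: "sets p = sets (borel_of_omet X)"
    using assms(1) by (simp_all add: radon_prob_def)
  have "emeasure p (space p) = (SUP K\<in>{K. compactin (top_of X) K \<and> K \<subseteq> space p}. emeasure p K)"
    using assms(1) sets.top[of p] unfolding radon_prob_def by blast
  \<comment> \<open>A negative \<open>1 - \<epsilon>\<close> becomes 0 under \<open>ennreal\<close>,
    which is still below the total mass 1.\<close>
  moreover have "ennreal (1 - \<epsilon>) < emeasure p (space p)"
    using ennreal_lessI[of 1 "1 - \<epsilon>"] assms(2) by (simp add: emeasure_space_1)
  ultimately obtain K where K: "compactin mtopology K" "ennreal (1 - \<epsilon>) < emeasure p K"
    by (auto simp: less_SUP_iff top_of_eq)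
  obtain N where N: "finite N" "N \<subseteq> K" "K \<subseteq> (\<Union>a\<in>N. mball a \<delta>)"
    using compactin_imp_mtotally_bounded[OF K(1), unfolded mtotally_bounded_def, rule_format, OF assms(3)]
    by (elim exE conjE)
  have "(\<Union>a\<in>N. mball a \<delta>) \<in> sets p" unfolding sets_p using N(1) by (intro sets.finite_UN) auto
  then have "emeasure p K \<le> emeasure p (\<Union>a\<in>N. mball a \<delta>)" by (rule emeasure_mono[OF N(3)])
  from less_le_trans[OF K(2) this] have "ennreal (1 - \<epsilon>) < ennreal (measure p (\<Union>a\<in>N. mball a \<delta>))"
    unfolding emeasure_eq_measure .
  then have "1 - \<epsilon> < measure p (\<Union>a\<in>N. mball a \<delta>)"
    by (meson ennreal_leI not_le)
  moreover have "N \<subseteq> pts X" using N(2) compactin_subset_topspace[OF K(1)] by auto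
  ultimately show thesis using that N(1) by blast
qed

text \<open>\<open>D\<close> collects nets of radius \<open>1 / (n + 1)\<close> that miss less than
  mass \<open>1 / (m + 1)\<close>. For fixed \<open>n\<close> the balls of that radius around
  \<open>D\<close> have measure at least \<open>1 - 1 / (m + 1)\<close> for every \<open>m\<close>,
  hence 1, and countably many such conditions hold together almost everywhere.\<close>

lemma radon_near:
  assumes "radon_prob X p"
  obtains D where "countable D" "D \<subseteq> pts X" "AE x in p. x \<in> near D"
proof -
  interpret prob_space p using assms(1) by (simp add: radon_prob_def)
  have sp: "space p = pts X" and sets_p: "sets p = sets (borel_of_omet X)"
    using assms(1) by (simp_all add: radon_prob_def)
  have "\<exists>N. finite N \<and> N \<subseteq> pts X \<and> 1 - 1 / real (Suc m) < measure p (\<Union>a\<in>N. mball a (1 / real (Suc n)))" for n m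
    by (rule radon_finite_net[OF assms, of "1 / real (Suc m)" "1 / real (Suc n)"]) auto
  then have "\<exists>N. \<forall>n m. finite (N n m) \<and> N n m \<subseteq> pts X \<and>
      1 - 1 / real (Suc m) < measure p (\<Union>a\<in>N n m. mball a (1 / real (Suc n)))"
    by (intro choice allI)
  then obtain N where *: "\<forall>n m. finite (N n m) \<and> N n m \<subseteq> pts X \<and>
      1 - 1 / real (Suc m) < measure p (\<Union>a\<in>N n m. mball a (1 / real (Suc n)))" ..
  have N: "finite (N n m)" "N n m \<subseteq> pts X"
    "1 - 1 / real (Suc m) < measure p (\<Union>a\<in>N n m. mball a (1 / real (Suc n)))" for n m
    using * by simp_all
  let ?D = "\<Union>n m. N n m"
  let ?B = "\<lambda>n. \<Union>a\<in>?D. mball a (1 / real (Suc n))"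
  have D: "countable ?D" by (rule countable_UN[OF countableI_type countable_UN[OF countableI_type countable_finite[OF N(1)]]])
  have B: "?B n \<in> sets p" for n unfolding sets_p by (intro sets.countable_UN'[OF D] image_subsetI ball_borel)
  have "measure p (?B n) \<ge> 1" for n
  proof (rule field_le_epsilon)
    fix e :: real assume "e > 0"
    then obtain m where m: "1 / real (Suc m) < e" using nat_approx_posE by blast
    have "measure p (\<Union>a\<in>N n m. mball a (1 / real (Suc n))) \<le> measure p (?B n)"
      using B by (intro finite_measure_mono) auto
    then show "1 \<le> measure p (?B n) + e" using N(3)[of m n] m by linarith
  qed
  then have "AE x in p. x \<in> ?B n" for n
    using B by (subst AE_in_set_eq_1) (auto intro: antisym)
  then have "AE x in p. \<forall>n. x \<in> ?B n" by (simp add: AE_all_countable)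
  then have "AE x in p. x \<in> near ?D" by eventually_elim (auto simp: near_def)
  then show thesis using that[of ?D] D N(2) by blast
qed

text \<open>Sets squeezed between a closed and an open set up to arbitrarily small mass form a
  sigma-algebra that contains the closed sets. The open set, absent from the conclusion, is carried
  through the induction because complementation exchanges the two roles.\<close>

lemma closed_inner_regular:
  assumes p: "prob_space p" "sets p = sets (borel_of_omet X)"
    and B: "B \<in> sets p" and e: "\<epsilon> > 0"
  obtains C where "closedin (top_of X) C" "C \<subseteq> B" "measure p (B - C) < \<epsilon>"
proof -
  interpret prob_space p by fact
  have sp: "space p = pts X" using sets_eq_imp_space_eq[OF p(2)] by simp
  have cl: "closedin (top_of X) C \<Longrightarrow> C \<in> sets p" for C using closedin_borel_on p(2) by simp
  have op: "openin (top_of X) C \<Longrightarrow> C \<in> sets p" for C using openin_borel_on p(2) by simp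
  let ?P = "\<lambda>B. B \<in> sets p \<and> (\<forall>\<epsilon>>0. \<exists>C U. closedin (top_of X) C \<and> openin (top_of X) U \<and> C \<subseteq> B \<and> B \<subseteq> U \<and> measure p (U - C) < \<epsilon>)"
  have "B \<in> sigma_sets (topspace (top_of X)) {C. closedin (top_of X) C}"
    using B p(2) sets_borel_on_closed by metis
  then have "?P B"
  proof (induction rule: sigma_sets.induct)
    case (Basic C)
    then have C: "closedin (top_of X) C" by simp
    show ?case
    proof (intro conjI allI impI cl C)
      fix \<epsilon> :: real assume "\<epsilon> > 0"
      show "\<exists>C' U. closedin (top_of X) C' \<and> openin (top_of X) U \<and> C' \<subseteq> C \<and> C \<subseteq> U \<and> measure p (U - C') < \<epsilon>"
      proof (cases "C = {}")
        case True
        then show ?thesis using \<open>\<epsilon> > 0\<close> by (intro exI[of _ "{}"]) auto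
      next
        case False
        have CX: "C \<subseteq> pts X" using closedin_subset[OF C] by simp
        have cont: "continuous_map (top_of X) euclidean (set_dst X C)"
          using short_map_continuous[OF metric_omet_axioms metric_omet_real_line set_dst_short[OF False CX]] by simp
        \<comment> \<open>A closed set is the intersection of its open
          \<open>1 / (n + 1)\<close>-neighbourhoods, so their measures decrease to that of
          \<open>C\<close>.\<close>
        let ?U = "\<lambda>n. {x \<in> pts X. set_dst X C x < 1 / real (Suc n)}"
        have U: "openin (top_of X) (?U n)" for n
          using openin_continuous_map_preimage[OF cont, of "{..<1 / real (Suc n)}"] by simp
        have sub: "C \<subseteq> ?U n" for n
        proof
          fix x assume "x \<in> C"
          then show "x \<in> ?U n" using set_dst_le[of x C x] CX
            by (auto simp: subset_iff intro: le_less_trans[where y = 0])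
        qed
        have "(\<Inter>n. ?U n) \<subseteq> C"
        proof
          fix x assume x: "x \<in> (\<Inter>n. ?U n)"
          show "x \<in> C"
          proof (rule ccontr)
            assume "x \<notin> C"
            with x have "0 < set_dst X C x" using set_dst_pos[OF C False] by auto
            then obtain n where "1 / real (Suc n) < set_dst X C x" using nat_approx_posE by blast
            with x show False by (auto simp: not_less dest!: spec[of _ n])
          qed
        qed
        then have eq: "(\<Inter>n. ?U n) = C" using sub by blast
        have "(\<lambda>n. measure p (?U n)) \<longlonglongrightarrow> measure p (\<Inter>n. ?U n)"
        proof (rule finite_Lim_measure_decseq)
          show "range ?U \<subseteq> sets p" using op[OF U] by blast
          show "decseq ?U"
            by (rule decseq_SucI) (auto elim!: less_le_trans intro!: divide_left_mono)
        qed
        then have "(\<lambda>n. measure p (?U n)) \<longlonglongrightarrow> measure p C" by (simp only: eq)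
        then obtain n where "dist (measure p (?U n)) (measure p C) < \<epsilon>"
          using \<open>\<epsilon> > 0\<close> unfolding LIMSEQ_def by blast
        moreover have "measure p (?U n - C) = measure p (?U n) - measure p C"
          by (intro finite_measure_Diff op U cl C sub)
        ultimately have "measure p (?U n - C) < \<epsilon>" by (simp add: dist_real_def)
        then show ?thesis using C U sub by blast
      qed
    qed
  next
    case Empty
    show ?case by (auto intro!: exI[of _ "{}"])
  next
    case (Compl B)
    show ?case
    proof (intro conjI allI impI)
      show "topspace (top_of X) - B \<in> sets p" using Compl.IH sets.compl_sets[of B p] sp by simp
      fix \<epsilon> :: real assume "\<epsilon> > 0"
      then obtain C U where CU: "closedin (top_of X) C" "openin (top_of X) U" "C \<subseteq> B" "B \<subseteq> U" "measure p (U - C) < \<epsilon>"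
        using Compl.IH by blast
      have "(pts X - C) - (pts X - U) = U - C"
        using openin_subset[OF CU(2)] by auto
      moreover have "closedin (top_of X) (pts X - U)" "openin (top_of X) (pts X - C)"
        using CU(1,2) closedin_diff[OF closedin_topspace, of "top_of X" U] openin_diff[OF openin_topspace, of "top_of X" C] by simp_all
      ultimately show "\<exists>C U. closedin (top_of X) C \<and> openin (top_of X) U \<and> C \<subseteq> topspace (top_of X) - B \<and> topspace (top_of X) - B \<subseteq> U \<and> measure p (U - C) < \<epsilon>"
        using CU by (intro exI[of _ "pts X - U"] exI[of _ "pts X - C"]) auto
    qed
  next
    case (Union B)
    show ?case
    proof (intro conjI allI impI)
      show UB: "(\<Union>i. B i) \<in> sets p" using Union.IH by auto
      fix \<epsilon> :: real assume e: "\<epsilon> > 0"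
      \<comment> \<open>The errors sum to \<open>\<epsilon> / 4\<close>; a second quarter pays for
        cutting the union of the closed sets down to a finite one.\<close>
      then have "\<exists>C U. closedin (top_of X) C \<and> openin (top_of X) U \<and> C \<subseteq> B i \<and> B i \<subseteq> U \<and> measure p (U - C) < \<epsilon> / 4 * (1 / 2) ^ Suc i" for i
        by (intro Union.IH[of i, THEN conjunct2, rule_format]) simp
      then obtain C U where C: "\<And>i. closedin (top_of X) (C i)" and U: "\<And>i. openin (top_of X) (U i)"
        and CB: "\<And>i. C i \<subseteq> B i" and BU: "\<And>i. B i \<subseteq> U i"
        and small: "\<And>i. measure p (U i - C i) < \<epsilon> / 4 * (1 / 2) ^ Suc i" by metis
      have sC: "(\<Union>i. C i) \<in> sets p" using cl[OF C] by auto
      have sU: "(\<Union>i. U i) \<in> sets p" using op[OF U] by auto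
      have sums: "(\<lambda>i. \<epsilon> / 4 * (1 / 2) ^ Suc i) sums (\<epsilon> / 4 * 1)"
        by (intro sums_mult power_half_series)
      have summ: "summable (\<lambda>i. measure p (U i - C i))"
        using small by (intro summable_comparison_test'[OF sums_summable[OF sums], of 0]) (auto intro: less_imp_le)
      have "measure p ((\<Union>i. U i) - (\<Union>i. C i)) \<le> measure p (\<Union>i. U i - C i)"
        using op[OF U] cl[OF C] by (intro finite_measure_mono) auto
      also have "\<dots> \<le> (\<Sum>i. measure p (U i - C i))"
        using summ op[OF U] cl[OF C] by (intro finite_measure_subadditive_countably) auto
      also have "\<dots> \<le> (\<Sum>i. \<epsilon> / 4 * (1 / 2) ^ Suc i)"
        using small summ sums_summable[OF sums] by (intro suminf_le) (auto intro: less_imp_le)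
      also have "\<dots> = \<epsilon> / 4" using sums_unique[OF sums] by simp
      finally have 1: "measure p ((\<Union>i. U i) - (\<Union>i. C i)) \<le> \<epsilon> / 4" .
      \<comment> \<open>The countable union of the \<open>C i\<close> need not be closed, so a
        finite partial union of almost the same measure replaces it.\<close>
      have "(\<lambda>n. measure p (\<Union>i\<le>n. C i)) \<longlonglongrightarrow> measure p (\<Union>n. \<Union>i\<le>n. C i)"
      proof (rule finite_Lim_measure_incseq)
        show "range (\<lambda>n. \<Union>i\<le>n. C i) \<subseteq> sets p" using cl[OF C] by auto
        show "incseq (\<lambda>n. \<Union>i\<le>n. C i)" by (rule incseq_SucI) (auto simp: atMost_Suc)
      qed
      moreover have "(\<Union>n. \<Union>i\<le>n. C i) = (\<Union>i. C i)" by auto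
      ultimately have "(\<lambda>n. measure p (\<Union>i\<le>n. C i)) \<longlonglongrightarrow> measure p (\<Union>i. C i)" by simp
      then obtain n where n: "dist (measure p (\<Union>i\<le>n. C i)) (measure p (\<Union>i. C i)) < \<epsilon> / 4"
        using e unfolding LIMSEQ_def by (meson divide_pos_pos zero_less_numeral order_refl)
      have Cn: "closedin (top_of X) (\<Union>i\<le>n. C i)" using C by (intro closedin_Union) auto
      have "measure p ((\<Union>i. U i) - (\<Union>i\<le>n. C i)) = measure p (\<Union>i. U i) - measure p (\<Union>i\<le>n. C i)"
        using CB BU by (intro finite_measure_Diff sU cl Cn) blast
      moreover have "measure p ((\<Union>i. U i) - (\<Union>i. C i)) = measure p (\<Union>i. U i) - measure p (\<Union>i. C i)"
        using CB BU by (intro finite_measure_Diff sU sC) blast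
      ultimately have "measure p ((\<Union>i. U i) - (\<Union>i\<le>n. C i)) < \<epsilon>"
        using n 1 e unfolding dist_real_def by linarith
      moreover have "openin (top_of X) (\<Union>i. U i)" using U by auto
      moreover have "(\<Union>i\<le>n. C i) \<subseteq> (\<Union>i. B i)" "(\<Union>i. B i) \<subseteq> (\<Union>i. U i)" using CB BU by blast+
      ultimately show "\<exists>C U. closedin (top_of X) C \<and> openin (top_of X) U \<and> C \<subseteq> (\<Union>i. B i) \<and> (\<Union>i. B i) \<subseteq> U \<and> measure p (U - C) < \<epsilon>"
        using Cn by blast
    qed
  qed
  then obtain C U where CU: "closedin (top_of X) C" "openin (top_of X) U" "C \<subseteq> B" "B \<subseteq> U" "measure p (U - C) < \<epsilon>"
    using e by blast
  have "measure p (B - C) \<le> measure p (U - C)"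
    using CU op cl by (intro finite_measure_mono) auto
  then have "measure p (B - C) < \<epsilon>" using CU(5) by linarith
  then show thesis by (rule that[OF CU(1,3)])
qed

end


section \<open>Tightness and completeness\<close>

context metric_omet begin

text \<open>The set \<open>T\<close> of points lying in every \<open>B n\<close> is totally bounded,
  so by completeness its closure is compact. The mass missed at stage \<open>n\<close> is at most
  \<open>\<epsilon> * (1 / 2) ^ Suc n\<close>, and these bounds sum to
  \<open>\<epsilon>\<close>.\<close>

lemma tight_if_finite_nets:
  assumes p: "prob_space p" "sets p = sets (borel_of_omet X)"
    and comp: mcomplete
    and nets: "\<And>\<epsilon> \<delta>. \<epsilon> > 0 \<Longrightarrow> \<delta> > 0 \<Longrightarrow>
      \<exists>N. finite N \<and> N \<subseteq> pts X \<and> 1 - \<epsilon> \<le> measure p (\<Union>a\<in>N. mball a \<delta>)"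
    and e: "(\<epsilon>::real) > 0"
  obtains K where "compactin (top_of X) K" "measure p (pts X - K) \<le> \<epsilon>"
proof -
  interpret prob_space p by fact
  have sp: "space p = pts X" using sets_eq_imp_space_eq[OF p(2)] by simp
  have "\<exists>N. finite N \<and> N \<subseteq> pts X \<and> 1 - \<epsilon> * (1 / 2) ^ Suc n \<le> measure p (\<Union>a\<in>N. mball a (1 / real (Suc n)))" for n
    by (rule nets) (use e in auto)
  then have "\<exists>N. \<forall>n. finite (N n) \<and> N n \<subseteq> pts X \<and>
      1 - \<epsilon> * (1 / 2) ^ Suc n \<le> measure p (\<Union>a\<in>N n. mball a (1 / real (Suc n)))"
    by (intro choice allI)
  then obtain N where *: "\<forall>n. finite (N n) \<and> N n \<subseteq> pts X \<and>
      1 - \<epsilon> * (1 / 2) ^ Suc n \<le> measure p (\<Union>a\<in>N n. mball a (1 / real (Suc n)))" ..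
  have N: "finite (N n)" "N n \<subseteq> pts X"
     "1 - \<epsilon> * (1 / 2) ^ Suc n \<le> measure p (\<Union>a\<in>N n. mball a (1 / real (Suc n)))" for n
    using * by simp_all
  define B where "B = (\<lambda>n. \<Union>a\<in>N n. mball a (1 / real (Suc n)))"
  define T where "T = (\<Inter>n. B n)"
  have B: "B n \<in> sets p" for n unfolding p(2) B_def by (intro sets.finite_UN N ball_borel)
  have TX: "T \<subseteq> pts X" by (auto simp: T_def B_def)
  have tb: "mtotally_bounded T"
    unfolding mtotally_bounded_def
  proof (intro allI impI)
    fix d :: real assume "d > 0"
    \<comment> \<open>\<open>mtotally_bounded\<close> asks for centres inside \<open>T\<close>, so
      each ball of the net that meets \<open>T\<close> is recentred at a point of \<open>T\<close>.
      This doubles the radius, hence the bound \<open>d / 2\<close>.\<close>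
    then obtain n where n: "1 / real (Suc n) < d / 2" using nat_approx_posE half_gt_zero by blast
    let ?M = "{a \<in> N n. mball a (1 / real (Suc n)) \<inter> T \<noteq> {}}"
    let ?t = "\<lambda>a. SOME x. x \<in> mball a (1 / real (Suc n)) \<inter> T"
    have t: "?t a \<in> mball a (1 / real (Suc n)) \<inter> T" if "a \<in> ?M" for a
    proof -
      have "mball a (1 / real (Suc n)) \<inter> T \<noteq> {}" using that by simp
      then obtain x where "x \<in> mball a (1 / real (Suc n)) \<inter> T" unfolding ex_in_conv[symmetric] ..
      then show ?thesis by (rule someI)
    qed
    show "\<exists>K. finite K \<and> K \<subseteq> T \<and> T \<subseteq> (\<Union>x\<in>K. mball x d)"
    proof (intro exI[of _ "?t ` ?M"] conjI)
      show "finite (?t ` ?M)" using N(1) by simp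
      show "?t ` ?M \<subseteq> T" using t by blast
      show "T \<subseteq> (\<Union>x\<in>?t ` ?M. mball x d)"
      proof
        fix x assume x: "x \<in> T"
        then have "x \<in> B n" by (simp add: T_def)
        then obtain a where a: "a \<in> N n" "x \<in> mball a (1 / real (Suc n))" unfolding B_def by blast
        then have aM: "a \<in> ?M" using x by blast
        have ta: "?t a \<in> mball a (1 / real (Suc n))" using t[OF aM] by blast
        have "dst X (?t a) x \<le> dst X (?t a) a + dst X a x"
          using a ta by (intro triangle) auto
        also have "\<dots> < d" using a(2) ta n commute[of "?t a" a] by (simp only: in_mball) linarith
        finally have "x \<in> mball (?t a) d" using a(2) ta by (simp only: in_mball)
        then show "x \<in> (\<Union>x\<in>?t ` ?M. mball x d)" using aM by blast
      qed
    qed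
  qed
  define K where "K = mtopology closure_of T"
  have K: "compactin (top_of X) K"
    using mtotally_bounded_eq_compact_closure_of[OF comp] tb unfolding K_def top_of_eq by blast
  have TK: "T \<subseteq> K" unfolding K_def using TX by (intro closure_of_subset) simp
  have small: "measure p (pts X - B n) \<le> \<epsilon> * (1 / 2) ^ Suc n" for n
    using N(3)[of n] prob_compl[OF B[of n]] sp by (simp add: B_def)
  have sums: "(\<lambda>i. \<epsilon> * (1 / 2) ^ Suc i) sums (\<epsilon> * 1)"
    by (intro sums_mult power_half_series)
  have summ: "summable (\<lambda>i. measure p (pts X - B i))"
    using small by (intro summable_comparison_test'[OF sums_summable[OF sums], of 0]) simp
  have cB: "pts X - B i \<in> sets p" for i using sets.compl_sets[OF B] sp by simp
  have "measure p (pts X - K) \<le> measure p (\<Union>i. pts X - B i)"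
  proof (rule finite_measure_mono)
    show "pts X - K \<subseteq> (\<Union>i. pts X - B i)" using TK by (auto simp: T_def)
    show "(\<Union>i. pts X - B i) \<in> sets p" by (intro sets.countable_UN image_subsetI cB)
  qed
  also have "\<dots> \<le> (\<Sum>i. measure p (pts X - B i))"
    using summ cB by (intro finite_measure_subadditive_countably) auto
  also have "\<dots> \<le> (\<Sum>i. \<epsilon> * (1 / 2) ^ Suc i)"
    using small summ sums_summable[OF sums] by (intro suminf_le) auto
  also have "\<dots> = \<epsilon>" using sums_unique[OF sums] by simp
  finally show thesis using that K by blast
qed

text \<open>A Borel set contains a closed \<open>C\<close> with nearly all of its mass by
  \<open>closed_inner_regular\<close>, and tightness provides a compact \<open>K\<close> of nearly
  full mass; \<open>C \<inter> K\<close> is compact and loses at most the sum of the two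
  errors.\<close>

lemma radon_if_finite_nets:
  assumes p: "prob_space p" "sets p = sets (borel_of_omet X)"
    and comp: mcomplete
    and nets: "\<And>\<epsilon> \<delta>. \<epsilon> > 0 \<Longrightarrow> \<delta> > 0 \<Longrightarrow>
      \<exists>N. finite N \<and> N \<subseteq> pts X \<and> 1 - \<epsilon> \<le> measure p (\<Union>a\<in>N. mball a \<delta>)"
  shows "radon_prob X p"
  unfolding radon_prob_def
proof (intro conjI ballI p)
  interpret prob_space p by fact
  show sp: "space p = pts X" using sets_eq_imp_space_eq[OF p(2)] by simp
  fix B assume B: "B \<in> sets p"
  have cl: "closedin (top_of X) C \<Longrightarrow> C \<in> sets p" for C using closedin_borel_on p(2) by simp
  have kcl: "compactin (top_of X) K \<Longrightarrow> closedin (top_of X) K" for K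
    unfolding top_of_eq by (rule compactin_imp_closedin[OF Hausdorff_space_mtopology])
  show "emeasure p B = (SUP K\<in>{K. compactin (top_of X) K \<and> K \<subseteq> B}. emeasure p K)"
  proof (rule antisym)
    show "(SUP K\<in>{K. compactin (top_of X) K \<and> K \<subseteq> B}. emeasure p K) \<le> emeasure p B"
      using B by (intro SUP_least emeasure_mono) auto
    show "emeasure p B \<le> (SUP K\<in>{K. compactin (top_of X) K \<and> K \<subseteq> B}. emeasure p K)"
    proof (rule ennreal_le_epsilon)
      fix e :: real assume e: "e > 0"
      obtain C where C: "closedin (top_of X) C" "C \<subseteq> B" "measure p (B - C) < e / 2"
        using closed_inner_regular[OF p B, of "e / 2"] e half_gt_zero by blast
      obtain K where K: "compactin (top_of X) K" "measure p (pts X - K) \<le> e / 2"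
        using tight_if_finite_nets[OF p comp nets, of "e / 2"] e half_gt_zero by blast
      have CK: "compactin (top_of X) (C \<inter> K)" by (rule closed_Int_compactin[OF C(1) K(1)])
      have m: "C \<in> sets p" "K \<in> sets p" "C \<inter> K \<in> sets p" "pts X - K \<in> sets p"
        using cl[OF C(1)] cl[OF kcl[OF K(1)]] sets.compl_sets[of K p] sp by auto
      have "measure p B \<le> measure p (C \<inter> K \<union> ((B - C) \<union> (pts X - K)))"
        using m B sets.sets_into_space[OF B] sp by (intro finite_measure_mono) auto
      also have "\<dots> \<le> measure p (C \<inter> K) + (measure p (B - C) + measure p (pts X - K))"
        using m B by (intro order_trans[OF measure_Un_le] add_left_mono measure_Un_le) auto
      also have "\<dots> \<le> measure p (C \<inter> K) + e" using C(3) K(2) by simp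
      finally have "emeasure p B \<le> emeasure p (C \<inter> K) + ennreal e"
        using e by (simp add: emeasure_eq_measure ennreal_plus[symmetric] ennreal_leI del: ennreal_plus)
      also have "\<dots> \<le> (SUP K\<in>{K. compactin (top_of X) K \<and> K \<subseteq> B}. emeasure p K) + ennreal e"
        using CK C(2) by (intro add_right_mono SUP_upper) auto
      finally show "emeasure p B \<le> (SUP K\<in>{K. compactin (top_of X) K \<and> K \<subseteq> B}. emeasure p K) + ennreal e" .
    qed
  qed
qed

end

section \<open>Couplings\<close>

abbreviation borel2_of_omet :: "'a omet \<Rightarrow> ('a \<times> 'a) measure" where
  "borel2_of_omet X \<equiv> borel_on (prod_topology (top_of X) (top_of X))"

context metric_omet begin

lemma fst_borel2 [measurable]: "fst \<in> borel2_of_omet X \<rightarrow>\<^sub>M borel_of_omet X"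
  by (intro continuous_map_measurable_borel_on continuous_map_fst)

lemma snd_borel2 [measurable]: "snd \<in> borel2_of_omet X \<rightarrow>\<^sub>M borel_of_omet X"
  by (intro continuous_map_measurable_borel_on continuous_map_snd)

text \<open>Each point of \<open>U\<close> in the square of \<open>near D\<close> lies in a product
  of two balls of equal radius centred in \<open>D\<close> and contained in \<open>U\<close>. Only
  countably many such rectangles exist, and each is in the product sigma-algebra.\<close>

lemma open_inter_near:
  assumes U: "openin (prod_topology (top_of X) (top_of X)) U" and D: "countable D"
  shows "U \<inter> near D \<times> near D \<in> sets (borel_of_omet X \<Otimes>\<^sub>M borel_of_omet X)"
proof -
  define R where "R a b n = mball a (1 / real (Suc n)) \<times> mball b (1 / real (Suc n))" for a b n
  define I where "I = {(a, b, n). a \<in> D \<and> b \<in> D \<and> R a b n \<subseteq> U}"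
  have I: "countable I"
    by (rule countable_subset[of _ "D \<times> D \<times> UNIV"]) (auto simp: I_def D)
  have "U \<inter> near D \<times> near D = (\<Union>(a, b, n)\<in>I. R a b n) \<inter> near D \<times> near D"
  proof (intro equalityI subsetI)
    fix z assume z: "z \<in> U \<inter> near D \<times> near D"
    obtain x y where xy: "z = (x, y)" by (cases z)
    then have "x \<in> near D" "y \<in> near D" "(x, y) \<in> U" using z by auto
    then obtain V W where VW: "openin mtopology V" "openin mtopology W" "x \<in> V" "y \<in> W" "V \<times> W \<subseteq> U"
      using U unfolding openin_prod_topology_alt top_of_eq by metis
    obtain r where r: "r > 0" "mball x r \<subseteq> V" using VW(1,3) unfolding openin_mtopology by metis
    obtain s where s: "s > 0" "mball y s \<subseteq> W" using VW(2,4) unfolding openin_mtopology by metis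
    \<comment> \<open>Half the radius, because a ball around \<open>a\<close> that contains
      \<open>x\<close> reaches up to twice its radius away from \<open>x\<close>.\<close>
    obtain n where n: "1 / real (Suc n) < min r s / 2"
      using nat_approx_posE[of "min r s / 2"] r(1) s(1) by auto
    obtain a where a: "a \<in> D" "x \<in> mball a (1 / real (Suc n))"
      using \<open>x \<in> near D\<close> unfolding near_def by blast
    obtain b where b: "b \<in> D" "y \<in> mball b (1 / real (Suc n))"
      using \<open>y \<in> near D\<close> unfolding near_def by blast
    have "mball a (1 / real (Suc n)) \<subseteq> mball x r"
      using a n commute[of a x] by (intro mball_subset) (simp_all only: in_mball, linarith)
    moreover have "mball b (1 / real (Suc n)) \<subseteq> mball y s"
      using b n commute[of b y] by (intro mball_subset) (simp_all only: in_mball, linarith)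
    ultimately have "R a b n \<subseteq> U" using r(2) s(2) VW(5) unfolding R_def by blast
    then have "(a, b, n) \<in> I" using a(1) b(1) by (simp add: I_def)
    moreover have "z \<in> R a b n" using a(2) b(2) xy by (simp add: R_def)
    ultimately show "z \<in> (\<Union>(a, b, n)\<in>I. R a b n) \<inter> near D \<times> near D" using z by blast
  next
    fix z assume "z \<in> (\<Union>(a, b, n)\<in>I. R a b n) \<inter> near D \<times> near D"
    then show "z \<in> U \<inter> near D \<times> near D" unfolding I_def by blast
  qed
  also have "\<dots> \<in> sets (borel_of_omet X \<Otimes>\<^sub>M borel_of_omet X)"
  proof (intro sets.Int pair_measureI near_borel D sets.countable_UN'[OF I] image_subsetI)
    fix i assume "i \<in> I"
    then show "(case i of (a, b, n) \<Rightarrow> R a b n) \<in> sets (borel_of_omet X \<Otimes>\<^sub>M borel_of_omet X)"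
      by (cases i) (auto simp: R_def)
  qed
  finally show ?thesis .
qed

text \<open>Induction over the generated sigma-algebra; the complement step is relative to the
  square \<open>near D \<times> near D\<close>, which is itself in the product sigma-algebra as
  \<open>D\<close> is countable.\<close>

lemma borel2_inter_near:
  assumes B: "B \<in> sets (borel2_of_omet X)" and D: "countable D"
  shows "B \<inter> near D \<times> near D \<in> sets (borel_of_omet X \<Otimes>\<^sub>M borel_of_omet X)"
  using B unfolding sets_borel_on
proof (induction rule: sigma_sets.induct)
  case (Basic U)
  then show ?case using open_inter_near[OF _ D] by simp
next
  case Empty
  show ?case by simp
next
  case (Compl B)
  have "(topspace (prod_topology (top_of X) (top_of X)) - B) \<inter> near D \<times> near D
      = near D \<times> near D - B \<inter> near D \<times> near D"
    by (auto simp: near_def)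
  also have "\<dots> \<in> sets (borel_of_omet X \<Otimes>\<^sub>M borel_of_omet X)"
    using D by (intro sets.Diff Compl.IH) auto
  finally show ?case .
next
  case (Union B)
  have eq: "(\<Union>i. B i) \<inter> near D \<times> near D = (\<Union>i. B i \<inter> near D \<times> near D)" by blast
  show ?case unfolding eq by (intro sets.countable_UN image_subsetI Union.IH)
qed

text \<open>The extension is an image measure: \<open>h\<close> is the identity on a square
  \<open>near D \<times> near D\<close> of full measure and constant off it, so preimages of Borel
  sets of the product topology land in the product sigma-algebra. Keeping \<open>h\<close> in the
  conclusion lets integrals against the coupling be computed over \<open>\<rho>\<close>.\<close>

lemma extends_to_coupling:
  assumes p: "radon_prob X p" and q: "radon_prob X q"
    and \<rho>: "prob_space \<rho>" "sets \<rho> = sets (borel_of_omet X \<Otimes>\<^sub>M borel_of_omet X)"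
      "distr \<rho> (borel_of_omet X) fst = p" "distr \<rho> (borel_of_omet X) snd = q"
  obtains h where "h \<in> \<rho> \<rightarrow>\<^sub>M borel2_of_omet X" "AE z in \<rho>. h z = z"
    "distr \<rho> (borel2_of_omet X) h \<in> couplings X p q"
proof -
  interpret prob_space \<rho> by fact
  obtain D1 where D1: "countable D1" "D1 \<subseteq> pts X" "AE x in p. x \<in> near D1" by (rule radon_near[OF p])
  obtain D2 where D2: "countable D2" "D2 \<subseteq> pts X" "AE x in q. x \<in> near D2" by (rule radon_near[OF q])
  \<comment> \<open>One countable set serves both marginals, so that the support is a square as in
    \<open>borel2_inter_near\<close>.\<close>
  define D where "D = D1 \<union> D2"
  have D: "countable D" using D1 D2 by (simp add: D_def)
  have f [measurable]: "fst \<in> \<rho> \<rightarrow>\<^sub>M borel_of_omet X" "snd \<in> \<rho> \<rightarrow>\<^sub>M borel_of_omet X"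
    using measurable_fst measurable_snd measurable_cong_sets[OF \<rho>(2) refl] by blast+
  have "AE z in \<rho>. fst z \<in> near D1" "AE z in \<rho>. snd z \<in> near D2"
    using D1(3) D2(3) unfolding \<rho>(3,4)[symmetric] by (auto dest: AE_distrD[OF f(1)] AE_distrD[OF f(2)])
  then have ae: "AE z in \<rho>. z \<in> near D \<times> near D"
    by eventually_elim (use near_mono[of D1 D] near_mono[of D2 D] in \<open>auto simp: mem_Times_iff D_def\<close>)
  have "near D \<times> near D \<noteq> {}"
  proof
    assume "near D \<times> near D = {}"
    with ae have "AE z in \<rho>. False" by simp
    then show False by simp
  qed
  then obtain z0 where z0: "z0 \<in> near D \<times> near D" unfolding ex_in_conv[symmetric] ..
  define h where "h z = (if z \<in> near D \<times> near D then z else z0)" for z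
  have N: "near D \<times> near D \<subseteq> pts X \<times> pts X" by (auto simp: near_def)
  have sp: "space \<rho> = pts X \<times> pts X" using sets_eq_imp_space_eq[OF \<rho>(2)] by (simp add: space_pair_measure)
  have NS: "near D \<times> near D \<in> sets \<rho>" using D unfolding \<rho>(2) by auto
  have h: "h \<in> \<rho> \<rightarrow>\<^sub>M borel2_of_omet X"
  proof (rule measurableI)
    fix z assume "z \<in> space \<rho>"
    then show "h z \<in> space (borel2_of_omet X)" using N z0 by (auto simp: h_def)
  next
    fix B assume B: "B \<in> sets (borel2_of_omet X)"
    \<comment> \<open>Off the square \<open>h\<close> takes the single value \<open>z0\<close>, so
      the preimage gains all or nothing there.\<close>
    have "h -` B \<inter> space \<rho> = (B \<inter> near D \<times> near D) \<union> (if z0 \<in> B then space \<rho> - near D \<times> near D else {})"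
    proof (rule set_eqI)
      fix z
      have "z \<in> near D \<times> near D \<Longrightarrow> z \<in> space \<rho>" using N sp by blast
      then show "z \<in> h -` B \<inter> space \<rho> \<longleftrightarrow>
          z \<in> (B \<inter> near D \<times> near D) \<union> (if z0 \<in> B then space \<rho> - near D \<times> near D else {})"
        by (cases "z \<in> near D \<times> near D"; cases "z0 \<in> B") (simp_all add: h_def)
    qed
    also have "\<dots> \<in> sets \<rho>"
      using borel2_inter_near[OF B D] NS unfolding \<rho>(2)[symmetric] by auto
    finally show "h -` B \<inter> space \<rho> \<in> sets \<rho>" .
  qed
  have hz: "AE z in \<rho>. h z = z" using ae by eventually_elim (simp add: h_def)
  have "distr (distr \<rho> (borel2_of_omet X) h) (borel_of_omet X) fst = distr \<rho> (borel_of_omet X) fst"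
    using hz h by (subst distr_distr) (auto intro!: distr_cong_AE)
  moreover have "distr (distr \<rho> (borel2_of_omet X) h) (borel_of_omet X) snd = distr \<rho> (borel_of_omet X) snd"
    using hz h by (subst distr_distr) (auto intro!: distr_cong_AE)
  ultimately have "distr \<rho> (borel2_of_omet X) h \<in> couplings X p q"
    using prob_space_distr[OF h] \<rho>(3,4) by (simp add: couplings_def)
  with h hz show thesis by (rule that)
qed

text \<open>The product measure has the right marginals and extends. Nonemptiness matters because
  the infimum of an empty set of reals, which \<open>P_dst\<close> would then take, is
  meaningless.\<close>

lemma couplings_nonempty:
  assumes p: "radon_prob X p" and q: "radon_prob X q"
  shows "couplings X p q \<noteq> {}"
proof -
  interpret p: prob_space p using p by (simp add: radon_prob_def)
  interpret q: prob_space q using q by (simp add: radon_prob_def)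
  interpret pq: pair_prob_space p q ..
  have s: "sets p = sets (borel_of_omet X)" "sets q = sets (borel_of_omet X)"
    using p q by (simp_all add: radon_prob_def)
  have "distr (p \<Otimes>\<^sub>M q) (borel_of_omet X) fst = distr (p \<Otimes>\<^sub>M q) p fst"
    by (rule distr_cong) (simp_all add: s)
  also have "\<dots> = p" by (rule q.distr_pair_fst)
  finally have 1: "distr (p \<Otimes>\<^sub>M q) (borel_of_omet X) fst = p" .
  \<comment> \<open>The second marginal of the product is the first marginal of the swapped
    product.\<close>
  have "distr (p \<Otimes>\<^sub>M q) (borel_of_omet X) snd = distr (p \<Otimes>\<^sub>M q) q snd"
    by (rule distr_cong) (simp_all add: s)
  also have "\<dots> = distr (distr (q \<Otimes>\<^sub>M p) (p \<Otimes>\<^sub>M q) (\<lambda>(x, y). (y, x))) q snd"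
    by (rule arg_cong[OF pq.distr_pair_swap])
  also have "\<dots> = distr (q \<Otimes>\<^sub>M p) q fst"
    by (subst distr_distr) (auto simp: o_def case_prod_beta intro!: distr_cong)
  also have "\<dots> = q" by (rule p.distr_pair_fst)
  finally have 2: "distr (p \<Otimes>\<^sub>M q) (borel_of_omet X) snd = q" .
  show ?thesis
    by (rule extends_to_coupling[OF p q pq.prob_space_axioms sets_pair_measure_cong[OF s] 1 2]) blast
qed

section \<open>Integrals against couplings\<close>

lemma couplingD:
  assumes "r \<in> couplings X p q"
  shows "prob_space r" "space r = pts X \<times> pts X" "sets r = sets (borel2_of_omet X)"
    "distr r (borel_of_omet X) fst = p" "distr r (borel_of_omet X) snd = q"
    "fst \<in> r \<rightarrow>\<^sub>M borel_of_omet X" "snd \<in> r \<rightarrow>\<^sub>M borel_of_omet X"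
    "(\<lambda>z. dst X (fst z) (snd z)) \<in> borel_measurable r"
  using assms measurable_cong_sets[of r "borel2_of_omet X" "borel_of_omet X" "borel_of_omet X"]
    measurable_cong_sets[of r "borel2_of_omet X" borel borel] 
    fst_borel2 snd_borel2 measurable_dst by (auto simp: couplings_def)

lemma P_ptsD:
  assumes "p \<in> P_pts X"
  shows "prob_space p" "space p = pts X" "sets p = sets (borel_of_omet X)" "radon_prob X p"
    "\<And>f. short_map X real_line f \<Longrightarrow> integrable p f" "pts X \<noteq> {}"
  using assms prob_space.not_empty[of p] by (auto simp: P_pts_def radon_prob_def finite_first_moment_def)

lemma coupling_integral:
  assumes r: "r \<in> couplings X p q" and pq: "p \<in> P_pts X" "q \<in> P_pts X" and f: "short_map X real_line f"
  shows "integrable r (\<lambda>z. f (fst z))" "integrable r (\<lambda>z. f (snd z))"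
    "(\<integral>z. f (fst z) \<partial>r) = (\<integral>x. f x \<partial>p)" "(\<integral>z. f (snd z) \<partial>r) = (\<integral>x. f x \<partial>q)"
proof -
  note R = couplingD[OF r]
  have fm: "f \<in> borel_measurable (borel_of_omet X)" by (rule short_real_measurable[OF f])
  show "integrable r (\<lambda>z. f (fst z))" "(\<integral>z. f (fst z) \<partial>r) = (\<integral>x. f x \<partial>p)"
    using integrable_distr_eq[OF R(6) fm] integral_distr[OF R(6) fm] P_ptsD(5)[OF pq(1) f] R(4) by auto
  show "integrable r (\<lambda>z. f (snd z))" "(\<integral>z. f (snd z) \<partial>r) = (\<integral>x. f x \<partial>q)"
    using integrable_distr_eq[OF R(7) fm] integral_distr[OF R(7) fm] P_ptsD(5)[OF pq(2) f] R(5) by auto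
qed

text \<open>By the triangle inequality through a base point \<open>a\<close>, the distance is at
  most the sum of the short function \<open>\<lambda>x. dst X x a\<close> over both coordinates, and
  finite first moment makes that sum integrable.\<close>

lemma coupling_integrable_dst:
  assumes r: "r \<in> couplings X p q" and pq: "p \<in> P_pts X" "q \<in> P_pts X"
  shows "integrable r (\<lambda>z. dst X (fst z) (snd z))"
proof -
  note R = couplingD[OF r]
  obtain a where a: "a \<in> pts X" using P_ptsD(6)[OF pq(1)] by blast
  show ?thesis
  proof (rule Bochner_Integration.integrable_bound)
    show "integrable r (\<lambda>z. dst X (fst z) a + dst X (snd z) a)"
      by (intro Bochner_Integration.integrable_add coupling_integral[OF r pq dst_short[OF a]])
    show "AE z in r. norm (dst X (fst z) (snd z)) \<le> norm (dst X (fst z) a + dst X (snd z) a)"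
    proof (rule AE_I2)
      fix z assume "z \<in> space r"
      then have "fst z \<in> pts X" "snd z \<in> pts X" unfolding R(2) by (simp_all add: mem_Times_iff)
      then have "dst X (fst z) (snd z) \<le> dst X (fst z) a + dst X (snd z) a"
        by (intro triangle' a)
      then show "norm (dst X (fst z) (snd z)) \<le> norm (dst X (fst z) a + dst X (snd z) a)"
        unfolding real_norm_def using nonneg[of "fst z" "snd z"] by linarith
    qed
  qed (rule R(8))
qed

lemma P_dst_le:
  assumes "r \<in> couplings X p q" "p \<in> P_pts X" "q \<in> P_pts X"
  shows "P_dst X p q \<le> (\<integral>z. dst X (fst z) (snd z) \<partial>r)"
  using assms unfolding P_dst_def
  by (auto intro!: cINF_lower bdd_belowI[of _ 0] integral_nonneg_AE)

lemma P_dst_ge: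
  assumes "p \<in> P_pts X" "q \<in> P_pts X"
    and "\<And>r. r \<in> couplings X p q \<Longrightarrow> c \<le> (\<integral>z. dst X (fst z) (snd z) \<partial>r)"
  shows "c \<le> P_dst X p q"
  using assms couplings_nonempty[OF P_ptsD(4) P_ptsD(4), of p q] unfolding P_dst_def
  by (auto intro!: cINF_greatest)

lemma P_dst_approx:
  assumes "p \<in> P_pts X" "q \<in> P_pts X" "e > 0"
  obtains r where "r \<in> couplings X p q" "(\<integral>z. dst X (fst z) (snd z) \<partial>r) < P_dst X p q + e"
  using P_dst_ge[OF assms(1,2), of "P_dst X p q + e"] assms(3) by (meson not_le less_add_same_cancel1 )

text \<open>The easy half of Kantorovich duality: under every coupling the difference
  \<open>f (fst z) - f (snd z)\<close> is bounded by the distance, and the bound passes to the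
  infimum. It yields both separation of points and shortness of integration against
  \<open>f\<close>.\<close>

lemma short_integral_diff_le:
  assumes "p \<in> P_pts X" "q \<in> P_pts X" and f: "short_map X real_line f"
  shows "\<bar>(\<integral>x. f x \<partial>p) - (\<integral>x. f x \<partial>q)\<bar> \<le> P_dst X p q"
proof (rule P_dst_ge)
  fix r assume r: "r \<in> couplings X p q"
  note R = couplingD[OF r] and I = coupling_integral[OF r assms]
  have "\<bar>(\<integral>x. f x \<partial>p) - (\<integral>x. f x \<partial>q)\<bar> = \<bar>\<integral>z. f (fst z) - f (snd z) \<partial>r\<bar>"
    using I by simp
  also have "\<dots> \<le> (\<integral>z. \<bar>f (fst z) - f (snd z)\<bar> \<partial>r)" by (rule integral_abs_bound)
  also have "\<dots> \<le> (\<integral>z. dst X (fst z) (snd z) \<partial>r)"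
  proof (rule integral_mono[OF _ coupling_integrable_dst[OF r assms(1,2)]])
    show "integrable r (\<lambda>z. \<bar>f (fst z) - f (snd z)\<bar>)" using I by auto
    fix z assume "z \<in> space r"
    then show "\<bar>f (fst z) - f (snd z)\<bar> \<le> dst X (fst z) (snd z)"
      using f R(2) by (auto simp: short_real_iff)
  qed
  finally show "\<bar>(\<integral>x. f x \<partial>p) - (\<integral>x. f x \<partial>q)\<bar> \<le> (\<integral>z. dst X (fst z) (snd z) \<partial>r)" .
qed (use assms in auto)

end

section \<open>The Kantorovich metric\<close>

text \<open>The product measure is restricted to pairs with equal labels and reweighted by
  \<open>1 / m i\<close> on the rectangle of label \<open>i\<close>, which has product mass
  \<open>m i * m i\<close>. Integrating out either coordinate turns the weight into
  \<open>1 / m i * m i\<close>, which is 1 almost everywhere, so both marginals survive.\<close>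

lemma glue_over_nat:
  fixes r1 :: "'a measure" and r2 :: "'b measure" and k1 :: "'a \<Rightarrow> nat" and k2 :: "'b \<Rightarrow> nat"
  assumes r: "prob_space r1" "prob_space r2"
    and k [measurable]: "k1 \<in> r1 \<rightarrow>\<^sub>M count_space UNIV" "k2 \<in> r2 \<rightarrow>\<^sub>M count_space UNIV"
    and eq: "distr r1 (count_space UNIV) k1 = distr r2 (count_space UNIV) k2"
  obtains \<nu> where "prob_space \<nu>" "sets \<nu> = sets (r1 \<Otimes>\<^sub>M r2)" "distr \<nu> r1 fst = r1" "distr \<nu> r2 snd = r2"
    "AE w in \<nu>. k1 (fst w) = k2 (snd w)"
proof -
  interpret r1: prob_space r1 by fact
  interpret r2: prob_space r2 by fact
  interpret pair_prob_space r1 r2 ..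
  define m where "m i = emeasure r1 (k1 -` {i} \<inter> space r1)" for i
  have m2: "m i = emeasure r2 (k2 -` {i} \<inter> space r2)" for i
    using arg_cong[OF eq, of "\<lambda>M. emeasure M {i}"] by (simp add: emeasure_distr m_def)
  have m_top: "m i \<noteq> \<top>" for i by (simp add: m_def)
  have cancel: "1 / m i * m i = 1" if "m i \<noteq> 0" for i
    using that m_top[of i] unfolding mult.commute[of "1 / m i"] ennreal_times_divide
    by (simp add: less_top)
  \<comment> \<open>In a cell of mass zero \<open>1 / m i * m i\<close> is 0 instead of 1. There are
    countably many such cells, so together they are null and can be discarded on both sides.\<close>
  have "AE a in r1. \<forall>i. k1 a = i \<longrightarrow> m i \<noteq> 0"
    unfolding AE_all_countable
  proof
    fix i
    show "AE a in r1. k1 a = i \<longrightarrow> m i \<noteq> 0"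
    proof (cases "m i = 0")
      case True
      then show ?thesis unfolding m_def
        by (intro AE_I[of _ _ "k1 -` {i} \<inter> space r1"]) auto
    qed simp
  qed
  then have ae1: "AE a in r1. m (k1 a) \<noteq> 0" by eventually_elim simp
  have "AE b in r2. \<forall>i. k2 b = i \<longrightarrow> m i \<noteq> 0"
    unfolding AE_all_countable
  proof
    fix i
    show "AE b in r2. k2 b = i \<longrightarrow> m i \<noteq> 0"
    proof (cases "m i = 0")
      case True
      then show ?thesis unfolding m2
        by (intro AE_I[of _ _ "k2 -` {i} \<inter> space r2"]) auto
    qed simp
  qed
  then have ae2: "AE b in r2. m (k2 b) \<noteq> 0" by eventually_elim simp
  \<comment> \<open>Conditionally on the common value of \<open>k1\<close> and \<open>k2\<close>, the two coordinates are independent.\<close>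
  define W where "W = (\<lambda>w. if k1 (fst w) = k2 (snd w) then 1 / m (k1 (fst w)) else 0)"
  have W [measurable]: "W \<in> borel_measurable (r1 \<Otimes>\<^sub>M r2)"
  proof -
    \<comment> \<open>\<open>W\<close> factors through a pair of naturals, where every function is
      measurable.\<close>
    have "(\<lambda>w. (k1 (fst w), k2 (snd w))) \<in> r1 \<Otimes>\<^sub>M r2 \<rightarrow>\<^sub>M count_space UNIV \<Otimes>\<^sub>M count_space UNIV"
      by measurable
    then have "(\<lambda>w. (k1 (fst w), k2 (snd w))) \<in> r1 \<Otimes>\<^sub>M r2 \<rightarrow>\<^sub>M count_space UNIV"
      by (simp add: pair_measure_countable)
    from measurable_compose[OF this, of "\<lambda>(i, j). if i = j then 1 / m i else 0" borel]
    show ?thesis by (simp add: W_def)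
  qed
  define \<nu> where "\<nu> = density (r1 \<Otimes>\<^sub>M r2) W"
  have sets_\<nu>: "sets \<nu> = sets (r1 \<Otimes>\<^sub>M r2)" by (simp add: \<nu>_def)
  have f [measurable]: "fst \<in> \<nu> \<rightarrow>\<^sub>M r1" "snd \<in> \<nu> \<rightarrow>\<^sub>M r2"
    by (simp_all add: \<nu>_def)
  have inner1: "(\<integral>\<^sup>+b. W (a, b) \<partial>r2) = 1 / m (k1 a) * m (k1 a)" for a
  proof -
    have "(\<integral>\<^sup>+b. W (a, b) \<partial>r2) = (\<integral>\<^sup>+b. 1 / m (k1 a) * indicator (k2 -` {k1 a} \<inter> space r2) b \<partial>r2)"
      by (intro nn_integral_cong) (auto simp: W_def indicator_def)
    also have "\<dots> = 1 / m (k1 a) * m (k1 a)"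
      unfolding m2[of "k1 a"] by (intro nn_integral_cmult_indicator) simp
    finally show ?thesis .
  qed
  have inner2: "(\<integral>\<^sup>+a. W (a, b) \<partial>r1) = 1 / m (k2 b) * m (k2 b)" for b
  proof -
    have "(\<integral>\<^sup>+a. W (a, b) \<partial>r1) = (\<integral>\<^sup>+a. 1 / m (k2 b) * indicator (k1 -` {k2 b} \<inter> space r1) a \<partial>r1)"
      by (intro nn_integral_cong) (auto simp: W_def indicator_def)
    also have "\<dots> = 1 / m (k2 b) * m (k2 b)"
      unfolding m_def[of "k2 b"] by (intro nn_integral_cmult_indicator) simp
    finally show ?thesis .
  qed
  have d1: "distr \<nu> r1 fst = r1"
  proof (rule measure_eqI)
    fix A assume "A \<in> sets (distr \<nu> r1 fst)"
    then have A [measurable]: "A \<in> sets r1" by simp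
    have "emeasure (distr \<nu> r1 fst) A = emeasure \<nu> (fst -` A \<inter> space \<nu>)"
      by (simp add: emeasure_distr)
    also have "\<dots> = (\<integral>\<^sup>+w. W w * indicator (fst -` A \<inter> space \<nu>) w \<partial>(r1 \<Otimes>\<^sub>M r2))"
      unfolding \<nu>_def using measurable_sets[OF measurable_fst A] by (subst emeasure_density) auto
    also have "\<dots> = (\<integral>\<^sup>+w. W w * indicator A (fst w) \<partial>(r1 \<Otimes>\<^sub>M r2))"
      by (intro nn_integral_cong) (auto simp: \<nu>_def indicator_def)
    also have "\<dots> = (\<integral>\<^sup>+a. \<integral>\<^sup>+b. W (a, b) * indicator A a \<partial>r2 \<partial>r1)"
      by (subst r2.nn_integral_fst[symmetric]) auto
    also have "\<dots> = (\<integral>\<^sup>+a. 1 / m (k1 a) * m (k1 a) * indicator A a \<partial>r1)"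
      by (intro nn_integral_cong) (simp add: nn_integral_multc inner1)
    also have "\<dots> = (\<integral>\<^sup>+a. indicator A a \<partial>r1)"
      using ae1 by (intro nn_integral_cong_AE, eventually_elim) (simp add: cancel)
    finally show "emeasure (distr \<nu> r1 fst) A = emeasure r1 A" by simp
  qed simp
  have d2: "distr \<nu> r2 snd = r2"
  proof (rule measure_eqI)
    fix A assume "A \<in> sets (distr \<nu> r2 snd)"
    then have A [measurable]: "A \<in> sets r2" by simp
    have "emeasure (distr \<nu> r2 snd) A = emeasure \<nu> (snd -` A \<inter> space \<nu>)"
      by (simp add: emeasure_distr)
    also have "\<dots> = (\<integral>\<^sup>+w. W w * indicator (snd -` A \<inter> space \<nu>) w \<partial>(r1 \<Otimes>\<^sub>M r2))"
      unfolding \<nu>_def using measurable_sets[OF measurable_snd A] by (subst emeasure_density) auto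
    also have "\<dots> = (\<integral>\<^sup>+w. W w * indicator A (snd w) \<partial>(r1 \<Otimes>\<^sub>M r2))"
      by (intro nn_integral_cong) (auto simp: \<nu>_def indicator_def)
    also have "\<dots> = (\<integral>\<^sup>+b. \<integral>\<^sup>+a. W (a, b) * indicator A b \<partial>r1 \<partial>r2)"
      by (subst nn_integral_snd[symmetric]) auto
    also have "\<dots> = (\<integral>\<^sup>+b. 1 / m (k2 b) * m (k2 b) * indicator A b \<partial>r2)"
      by (intro nn_integral_cong) (simp add: nn_integral_multc inner2)
    also have "\<dots> = (\<integral>\<^sup>+b. indicator A b \<partial>r2)"
      using ae2 by (intro nn_integral_cong_AE, eventually_elim) (simp add: cancel)
    finally show "emeasure (distr \<nu> r2 snd) A = emeasure r2 A" by simp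
  qed simp
  have "AE w in \<nu>. k1 (fst w) = k2 (snd w)"
    unfolding \<nu>_def AE_density[OF W] by (rule AE_I2) (simp add: W_def)
  moreover have "prob_space \<nu>"
    using prob_space_distrD[OF f(1)] r(1) d1 by simp
  ultimately show thesis using that sets_\<nu> d1 d2 by blast
qed

context metric_omet begin

text \<open>Two couplings, each within \<open>e / 4\<close> of optimal, are glued so that their
  middle points share a cell rather than coincide; the jump between two points of one cell costs at
  most \<open>e / 2\<close>, which completes the budget \<open>e\<close>. Only the outer coordinates
  are kept, and their joint law extends to a coupling of \<open>p\<close> and
  \<open>s\<close>.\<close>

lemma P_dst_triangle:
  assumes p: "p \<in> P_pts X" and q: "q \<in> P_pts X" and s: "s \<in> P_pts X"
  shows "P_dst X p s \<le> P_dst X p q + P_dst X q s"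
proof (rule field_le_epsilon)
  fix e :: real assume e: "e > 0"
  obtain r1 where r1: "r1 \<in> couplings X p q" "(\<integral>z. dst X (fst z) (snd z) \<partial>r1) < P_dst X p q + e / 4"
    using P_dst_approx[OF p q, of "e / 4"] e by (metis divide_pos_pos zero_less_numeral)
  obtain r2 where r2: "r2 \<in> couplings X q s" "(\<integral>z. dst X (fst z) (snd z) \<partial>r2) < P_dst X q s + e / 4"
    using P_dst_approx[OF q s, of "e / 4"] e by (metis divide_pos_pos zero_less_numeral)
  note R1 = couplingD[OF r1(1)] and R2 = couplingD[OF r2(1)]
  obtain D where D: "countable D" "D \<subseteq> pts X" "AE y in q. y \<in> near D" by (rule radon_near[OF P_ptsD(4)[OF q]])
  obtain n where n: "1 / real (Suc n) < e / 4" using nat_approx_posE[of "e / 4"] e by auto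
  \<comment> \<open>The label of \<open>y\<close> is the index of the first ball of radius
    \<open>1 / (n + 1)\<close>, in an enumeration of \<open>D\<close>, that contains
    \<open>y\<close>. Off \<open>near D\<close> the value may be arbitrary, since that set is null
    for \<open>q\<close>.\<close>
  define k where "k y = (LEAST i. y \<in> mball (from_nat_into D i) (1 / real (Suc n)))" for y
  have k [measurable]: "k \<in> borel_of_omet X \<rightarrow>\<^sub>M count_space UNIV"
    unfolding k_def by measurable
  have kD: "y \<in> mball (from_nat_into D (k y)) (1 / real (Suc n))" if y: "y \<in> near D" for y
  proof -
    obtain a where a: "a \<in> D" "y \<in> mball a (1 / real (Suc n))" using y unfolding near_def by blast
    obtain i where "from_nat_into D i = a" using from_nat_into_surj[OF D(1) a(1)] ..
    with a(2) have "y \<in> mball (from_nat_into D i) (1 / real (Suc n))" by (simp only:)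
    then show ?thesis unfolding k_def by (rule LeastI)
  qed
  have near_dst: "dst X y y' \<le> e / 2" if "y \<in> near D" "y' \<in> near D" "k y = k y'" for y y'
  proof -
    have "y \<in> mball (from_nat_into D (k y)) (1 / real (Suc n))" "y' \<in> mball (from_nat_into D (k y)) (1 / real (Suc n))"
      using kD[OF that(1)] kD[OF that(2)] that(3) by simp_all
    then have "dst X (from_nat_into D (k y)) y < e / 4" "dst X (from_nat_into D (k y)) y' < e / 4"
      "dst X y y' \<le> dst X (from_nat_into D (k y)) y + dst X (from_nat_into D (k y)) y'"
      using n by (auto intro: triangle'')
    then show ?thesis by linarith
  qed
  have m1: "(\<lambda>z. k (snd z)) \<in> r1 \<rightarrow>\<^sub>M count_space UNIV" by (rule measurable_compose[OF R1(7) k])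
  have m2: "(\<lambda>z. k (fst z)) \<in> r2 \<rightarrow>\<^sub>M count_space UNIV" by (rule measurable_compose[OF R2(6) k])
  \<comment> \<open>Both label laws are the law of \<open>k\<close> under the common marginal
    \<open>q\<close>, which is the compatibility that gluing requires.\<close>
  have "distr r1 (count_space UNIV) (\<lambda>z. k (snd z)) = distr q (count_space UNIV) k"
    unfolding R1(5)[symmetric] by (subst distr_distr[OF k R1(7)]) (simp add: o_def)
  moreover have "distr r2 (count_space UNIV) (\<lambda>z. k (fst z)) = distr q (count_space UNIV) k"
    unfolding R2(4)[symmetric] by (subst distr_distr[OF k R2(6)]) (simp add: o_def)
  ultimately obtain \<nu> where \<nu>: "prob_space \<nu>" "sets \<nu> = sets (r1 \<Otimes>\<^sub>M r2)" "distr \<nu> r1 fst = r1" "distr \<nu> r2 snd = r2"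
    "AE w in \<nu>. k (snd (fst w)) = k (fst (snd w))"
    using glue_over_nat[OF R1(1) R2(1) m1 m2] by auto
  have mf: "fst \<in> \<nu> \<rightarrow>\<^sub>M r1" "snd \<in> \<nu> \<rightarrow>\<^sub>M r2"
    using measurable_fst measurable_snd measurable_cong_sets[OF \<nu>(2) refl] by blast+
  have mfst: "(\<lambda>w. fst (fst w)) \<in> \<nu> \<rightarrow>\<^sub>M borel_of_omet X" by (rule measurable_compose[OF mf(1) R1(6)])
  have msnd: "(\<lambda>w. snd (snd w)) \<in> \<nu> \<rightarrow>\<^sub>M borel_of_omet X" by (rule measurable_compose[OF mf(2) R2(7)])
  define g where "g w = (fst (fst w), snd (snd w))" for w :: "('a \<times> 'a) \<times> ('a \<times> 'a)"
  have g: "g \<in> \<nu> \<rightarrow>\<^sub>M borel_of_omet X \<Otimes>\<^sub>M borel_of_omet X"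
    unfolding g_def using mfst msnd by (rule measurable_Pair)
  define \<rho> where "\<rho> = distr \<nu> (borel_of_omet X \<Otimes>\<^sub>M borel_of_omet X) g"
  have "distr \<rho> (borel_of_omet X) fst = distr \<nu> (borel_of_omet X) (\<lambda>w. fst (fst w))"
    unfolding \<rho>_def by (subst distr_distr[OF measurable_fst g]) (simp add: o_def g_def)
  also have "\<dots> = distr (distr \<nu> r1 fst) (borel_of_omet X) fst"
    by (subst distr_distr[OF R1(6) mf(1)]) (simp add: o_def)
  finally have \<rho>1: "distr \<rho> (borel_of_omet X) fst = p" unfolding \<nu>(3) R1(4) .
  have "distr \<rho> (borel_of_omet X) snd = distr \<nu> (borel_of_omet X) (\<lambda>w. snd (snd w))"
    unfolding \<rho>_def by (subst distr_distr[OF measurable_snd g]) (simp add: o_def g_def)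
  also have "\<dots> = distr (distr \<nu> r2 snd) (borel_of_omet X) snd"
    by (subst distr_distr[OF R2(7) mf(2)]) (simp add: o_def)
  finally have \<rho>2: "distr \<rho> (borel_of_omet X) snd = s" unfolding \<nu>(4) R2(5) .
  have \<rho>p: "prob_space \<rho>" unfolding \<rho>_def by (rule prob_space.prob_space_distr[OF \<nu>(1) g])
  have \<rho>s: "sets \<rho> = sets (borel_of_omet X \<Otimes>\<^sub>M borel_of_omet X)" by (simp add: \<rho>_def)
  obtain h where h: "h \<in> \<rho> \<rightarrow>\<^sub>M borel2_of_omet X" "AE z in \<rho>. h z = z"
    "distr \<rho> (borel2_of_omet X) h \<in> couplings X p s"
    by (rule extends_to_coupling[OF P_ptsD(4)[OF p] P_ptsD(4)[OF s] \<rho>p \<rho>s \<rho>1 \<rho>2])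
  have hg: "AE w in \<nu>. h (g w) = g w" using AE_distrD[OF g] h(2) unfolding \<rho>_def by blast
  have "AE z in r1. snd z \<in> near D" using AE_distrD[OF R1(7)] D(3) unfolding R1(5) by blast
  then have n1: "AE w in \<nu>. snd (fst w) \<in> near D" using AE_distrD[OF mf(1)] unfolding \<nu>(3) by blast
  have "AE z in r2. fst z \<in> near D" using AE_distrD[OF R2(6)] D(3) unfolding R2(4) by blast
  then have n2: "AE w in \<nu>. fst (snd w) \<in> near D" using AE_distrD[OF mf(2)] unfolding \<nu>(4) by blast
  have sp: "space \<nu> = (pts X \<times> pts X) \<times> (pts X \<times> pts X)"
    using sets_eq_imp_space_eq[OF \<nu>(2)] by (simp add: space_pair_measure R1(2) R2(2))
  let ?d = "\<lambda>z. dst X (fst z) (snd z)"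
  have i1: "integrable \<nu> (\<lambda>w. ?d (fst w))" "(\<integral>w. ?d (fst w) \<partial>\<nu>) = (\<integral>z. ?d z \<partial>r1)"
    using integrable_distr_eq[OF mf(1) R1(8)] integral_distr[OF mf(1) R1(8)] coupling_integrable_dst[OF r1(1) p q]
    unfolding \<nu>(3) by auto
  have i2: "integrable \<nu> (\<lambda>w. ?d (snd w))" "(\<integral>w. ?d (snd w) \<partial>\<nu>) = (\<integral>z. ?d z \<partial>r2)"
    using integrable_distr_eq[OF mf(2) R2(8)] integral_distr[OF mf(2) R2(8)] coupling_integrable_dst[OF r2(1) q s]
    unfolding \<nu>(4) by auto
  interpret \<nu>: prob_space \<nu> by (rule \<nu>(1))
  have mhg: "(\<lambda>w. h (g w)) \<in> \<nu> \<rightarrow>\<^sub>M borel2_of_omet X"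
    using g h(1) unfolding \<rho>_def by (auto intro: measurable_compose)
  have drho: "distr \<rho> (borel2_of_omet X) h = distr \<nu> (borel2_of_omet X) (\<lambda>w. h (g w))"
    using g h(1) unfolding \<rho>_def by (subst distr_distr) (auto simp: o_def)
  have "P_dst X p s \<le> (\<integral>z. ?d z \<partial>distr \<rho> (borel2_of_omet X) h)"
    by (rule P_dst_le[OF h(3) p s])
  also have "\<dots> = (\<integral>w. ?d (h (g w)) \<partial>\<nu>)"
    unfolding drho by (rule integral_distr[OF mhg measurable_dst])
  also have "\<dots> \<le> (\<integral>w. ?d (fst w) + e / 2 + ?d (snd w) \<partial>\<nu>)"
  proof (rule integral_mono_AE)
    show "integrable \<nu> (\<lambda>w. ?d (h (g w)))"
      using coupling_integrable_dst[OF h(3) p s] integrable_distr_eq[OF mhg measurable_dst] unfolding drho by simp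
    show "integrable \<nu> (\<lambda>w. ?d (fst w) + e / 2 + ?d (snd w))" using i1 i2 by auto
    show "AE w in \<nu>. ?d (h (g w)) \<le> ?d (fst w) + e / 2 + ?d (snd w)"
      using hg n1 n2 \<nu>(5) AE_space
    proof eventually_elim
      case (elim w)
      obtain x y y' z where w: "w = ((x, y), (y', z))" by (metis prod.collapse)
      have "x \<in> pts X" "y \<in> pts X" "y' \<in> pts X" "z \<in> pts X" using elim(5) w sp by auto
      from triangle[OF this(1,2,4)] triangle[OF this(2,3,4)]
      have "dst X x z \<le> dst X x y + dst X y z" "dst X y z \<le> dst X y y' + dst X y' z" .
      moreover have "dst X y y' \<le> e / 2" using near_dst[of y y'] elim(2,3,4) w by simp
      ultimately show ?case using elim(1) w by (simp add: g_def)
    qed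
  qed
  also have "\<dots> = (\<integral>z. ?d z \<partial>r1) + e / 2 + (\<integral>z. ?d z \<partial>r2)"
    using i1 i2 by (simp add: \<nu>.prob_space)
  finally show "P_dst X p s \<le> P_dst X p q + P_dst X q s + e" using r1(2) r2(2) by linarith
qed

lemma P_dst_nonneg: "0 \<le> P_dst X p q"
proof (cases "p \<in> P_pts X \<and> q \<in> P_pts X")
  case True
  then show ?thesis by (intro P_dst_ge integral_nonneg_AE) auto
qed (auto simp: P_dst_def)

lemma P_dst_commute_le:
  assumes p: "p \<in> P_pts X" and q: "q \<in> P_pts X"
  shows "P_dst X p q \<le> P_dst X q p"
proof (rule P_dst_ge[OF q p])
  fix r assume r: "r \<in> couplings X q p"
  note R = couplingD[OF r]
  have sw: "prod.swap \<in> borel2_of_omet X \<rightarrow>\<^sub>M borel2_of_omet X"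
    by (intro continuous_map_measurable_borel_on)
      (simp add: prod.swap_def[abs_def] continuous_map_pairedI continuous_map_fst continuous_map_snd)
  then have swr: "prod.swap \<in> r \<rightarrow>\<^sub>M borel2_of_omet X" using measurable_cong_sets[OF R(3) refl] by blast
  have c: "distr r (borel2_of_omet X) prod.swap \<in> couplings X p q"
    unfolding couplings_def
  proof (intro CollectI conjI)
    show "prob_space (distr r (borel2_of_omet X) prod.swap)" by (rule prob_space.prob_space_distr[OF R(1) swr])
    show "distr (distr r (borel2_of_omet X) prod.swap) (borel_of_omet X) fst = p"
      using R(5) by (subst distr_distr[OF fst_borel2 swr]) (simp add: o_def)
    show "distr (distr r (borel2_of_omet X) prod.swap) (borel_of_omet X) snd = q"
      using R(4) by (subst distr_distr[OF snd_borel2 swr]) (simp add: o_def)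
  qed simp_all
  have "P_dst X p q \<le> (\<integral>z. dst X (fst z) (snd z) \<partial>distr r (borel2_of_omet X) prod.swap)"
    by (rule P_dst_le[OF c p q])
  also have "\<dots> = (\<integral>z. dst X (snd z) (fst z) \<partial>r)"
    by (subst integral_distr[OF swr measurable_dst]) simp
  also have "\<dots> = (\<integral>z. dst X (fst z) (snd z) \<partial>r)" by (subst commute) (rule refl)
  finally show "P_dst X p q \<le> (\<integral>z. dst X (fst z) (snd z) \<partial>r)" .
qed

lemma P_dst_commute: "P_dst X p q = P_dst X q p"
proof (cases "p \<in> P_pts X \<and> q \<in> P_pts X")
  case True
  then show ?thesis using P_dst_commute_le by (intro antisym) auto
qed (auto simp: P_dst_def)

lemma P_dst_self:
  assumes p: "p \<in> P_pts X"
  shows "P_dst X p p = 0"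
proof (rule antisym[OF _ P_dst_nonneg])
  note P = P_ptsD[OF p]
  have "continuous_map (top_of X) (prod_topology (top_of X) (top_of X)) (\<lambda>x. (x, x))"
    by (intro continuous_map_pairedI) simp_all
  then have "(\<lambda>x. (x, x)) \<in> borel_of_omet X \<rightarrow>\<^sub>M borel2_of_omet X"
    by (rule continuous_map_measurable_borel_on)
  then have dg: "(\<lambda>x. (x, x)) \<in> p \<rightarrow>\<^sub>M borel2_of_omet X" using measurable_cong_sets[OF P(3) refl] by blast
  have id: "distr p (borel_of_omet X) (\<lambda>x. x) = p" by (rule distr_id2[OF P(3)[symmetric]])
  have c: "distr p (borel2_of_omet X) (\<lambda>x. (x, x)) \<in> couplings X p p"
    unfolding couplings_def
  proof (intro CollectI conjI)
    show "prob_space (distr p (borel2_of_omet X) (\<lambda>x. (x, x)))" by (rule prob_space.prob_space_distr[OF P(1) dg])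
    show "distr (distr p (borel2_of_omet X) (\<lambda>x. (x, x))) (borel_of_omet X) fst = p"
      by (subst distr_distr[OF fst_borel2 dg]) (simp add: o_def id)
    show "distr (distr p (borel2_of_omet X) (\<lambda>x. (x, x))) (borel_of_omet X) snd = p"
      by (subst distr_distr[OF snd_borel2 dg]) (simp add: o_def id)
  qed simp_all
  have "P_dst X p p \<le> (\<integral>z. dst X (fst z) (snd z) \<partial>distr p (borel2_of_omet X) (\<lambda>x. (x, x)))"
    by (rule P_dst_le[OF c p p])
  also have "\<dots> = (\<integral>x. dst X x x \<partial>p)"
    by (subst integral_distr[OF dg measurable_dst]) simp
  also have "\<dots> = (\<integral>x. 0 \<partial>p)" by (rule Bochner_Integration.integral_cong) (simp_all add: P(2))
  finally show "P_dst X p p \<le> 0" by simp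
qed

lemma P_dst_zero:
  assumes p: "p \<in> P_pts X" and q: "q \<in> P_pts X" and 0: "P_dst X p q = 0"
  shows "p = q"
  using short_integral_diff_le[OF p q] 0 P_ptsD[OF p] P_ptsD[OF q]
  by (intro prob_eq_if_short_integrals_eq) auto

end

lemma pts_P_obj [simp]: "pts (P_obj X) = P_pts X"
  and dst_P_obj [simp]: "dst (P_obj X) = P_dst X"
  and leq_P_obj [simp]: "leq (P_obj X) = P_leq X"
  by (simp_all add: P_obj_def)

text \<open>Makes the results of \<open>metric_omet\<close> available for \<open>P_obj X\<close>
  itself, and hence for measures on measures.\<close>

lemma metric_omet_P_obj:
  assumes "metric_omet X"
  shows "metric_omet (P_obj X)"
proof -
  interpret metric_omet X by fact
  show ?thesis
    unfolding metric_omet_def pts_P_obj dst_P_obj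
    by (rule Metric_space.intro)
      (use P_dst_nonneg P_dst_commute P_dst_self P_dst_zero P_dst_triangle in blast)+
qed

section \<open>Functoriality and the unit\<close>

text \<open>Compact subsets of the preimage of \<open>B\<close> have compact images inside
  \<open>B\<close> of at least the same mass. The Hausdorff assumption makes these images closed,
  hence Borel.\<close>

lemma radon_distr:
  assumes p: "radon_prob X p" and f: "continuous_map (top_of X) (top_of Y) f"
    and t: "topspace (top_of Y) = pts Y" "Hausdorff_space (top_of Y)"
  shows "radon_prob Y (distr p (borel_of_omet Y) f)"
  unfolding radon_prob_def
proof (intro conjI ballI)
  interpret prob_space p using p by (simp add: radon_prob_def)
  have sp: "space p = pts X" "sets p = sets (borel_of_omet X)" using p by (simp_all add: radon_prob_def)
  have fm: "f \<in> p \<rightarrow>\<^sub>M borel_of_omet Y"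
    using continuous_map_measurable_borel_on[OF f] measurable_cong_sets[OF sp(2) refl] by blast
  show "prob_space (distr p (borel_of_omet Y) f)" by (rule prob_space_distr[OF fm])
  show "space (distr p (borel_of_omet Y) f) = pts Y" by (simp add: t)
  show "sets (distr p (borel_of_omet Y) f) = sets (borel_of_omet Y)" by simp
  fix B assume "B \<in> sets (distr p (borel_of_omet Y) f)"
  then have B: "B \<in> sets (borel_of_omet Y)" by simp
  have pre: "f -` B \<inter> space p \<in> sets p" by (rule measurable_sets[OF fm B])
  show "emeasure (distr p (borel_of_omet Y) f) B =
      (SUP K\<in>{K. compactin (top_of Y) K \<and> K \<subseteq> B}. emeasure (distr p (borel_of_omet Y) f) K)"
  proof (rule antisym)
    show "(SUP K\<in>{K. compactin (top_of Y) K \<and> K \<subseteq> B}. emeasure (distr p (borel_of_omet Y) f) K)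
        \<le> emeasure (distr p (borel_of_omet Y) f) B"
      using B by (intro SUP_least emeasure_mono) auto
    have "emeasure (distr p (borel_of_omet Y) f) B = emeasure p (f -` B \<inter> space p)"
      by (rule emeasure_distr[OF fm B])
    also have "\<dots> = (SUP K\<in>{K. compactin (top_of X) K \<and> K \<subseteq> f -` B \<inter> space p}. emeasure p K)"
      using p pre unfolding radon_prob_def by blast
    also have "\<dots> \<le> (SUP K\<in>{K. compactin (top_of Y) K \<and> K \<subseteq> B}. emeasure (distr p (borel_of_omet Y) f) K)"
    proof (rule SUP_mono)
      fix K assume "K \<in> {K. compactin (top_of X) K \<and> K \<subseteq> f -` B \<inter> space p}"
      then have K: "compactin (top_of X) K" "K \<subseteq> f -` B \<inter> space p" by auto
      have fK: "compactin (top_of Y) (f ` K)" by (rule image_compactin[OF K(1) f])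
      have "emeasure p K \<le> emeasure (distr p (borel_of_omet Y) f) (f ` K)"
      proof -
        have fK': "f ` K \<in> sets (borel_of_omet Y)"
          by (rule closedin_borel_on[OF compactin_imp_closedin[OF t(2) fK]])
        have "emeasure p K \<le> emeasure p (f -` (f ` K) \<inter> space p)"
          using K(2) measurable_sets[OF fm fK'] by (intro emeasure_mono) auto
        then show ?thesis by (simp add: emeasure_distr[OF fm fK'])
      qed
      then show "\<exists>K'\<in>{K. compactin (top_of Y) K \<and> K \<subseteq> B}. emeasure p K \<le> emeasure (distr p (borel_of_omet Y) f) K'"
        using fK K(2) by (intro bexI[of _ "f ` K"]) auto
    qed
    finally show "emeasure (distr p (borel_of_omet Y) f) B
        \<le> (SUP K\<in>{K. compactin (top_of Y) K \<and> K \<subseteq> B}. emeasure (distr p (borel_of_omet Y) f) K)" .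
  qed
qed

locale short_omet = X: metric_omet X + Y: metric_omet Y
  for X :: "'a omet" and Y :: "'b omet" +
  fixes f :: "'a \<Rightarrow> 'b"
  assumes short: "short_map X Y f"
begin

lemma measurable_P_pts: "p \<in> P_pts X \<Longrightarrow> f \<in> p \<rightarrow>\<^sub>M borel_of_omet Y"
  using short_map_measurable[OF X.metric_omet_axioms Y.metric_omet_axioms short]
    measurable_cong_sets[OF X.P_ptsD(3) refl] by blast

lemma integral_distr_short:
  assumes "p \<in> P_pts X" "short_map Y real_line g"
  shows "(\<integral>y. g y \<partial>distr p (borel_of_omet Y) f) = (\<integral>x. g (f x) \<partial>p)"
  by (intro integral_distr measurable_P_pts Y.short_real_measurable assms)

lemma distr_P_pts:
  assumes p: "p \<in> P_pts X"
  shows "distr p (borel_of_omet Y) f \<in> P_pts Y"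
proof -
  have "radon_prob Y (distr p (borel_of_omet Y) f)"
    using short_map_continuous[OF X.metric_omet_axioms Y.metric_omet_axioms short] X.P_ptsD(4)[OF p]
    by (intro radon_distr) (auto simp: Y.top_of_eq Y.Hausdorff_space_mtopology)
  moreover have "integrable (distr p (borel_of_omet Y) f) g" if g: "short_map Y real_line g" for g
    using integrable_distr_eq[OF measurable_P_pts[OF p] Y.short_real_measurable[OF g]]
      X.P_ptsD(5)[OF p short_map_comp[OF short g]] by simp
  ultimately show ?thesis by (simp add: P_pts_def finite_first_moment_def)
qed

lemma P_map_eq: "p \<in> P_pts X \<Longrightarrow> P_map X Y f p = distr p (borel_of_omet Y) f"
  by (simp add: P_map_def)

lemma P_map_P_pts: "p \<in> P_pts X \<Longrightarrow> P_map X Y f p \<in> P_pts Y"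
  by (simp add: P_map_eq distr_P_pts)

text \<open>The same image coupling serves for shortness of \<open>P_map\<close>, by comparing
  costs, and for its monotonicity, by comparing supports.\<close>

lemma distr_coupling:
  assumes r: "r \<in> couplings X p q"
  shows "(\<lambda>z. (f (fst z), f (snd z))) \<in> r \<rightarrow>\<^sub>M borel2_of_omet Y"
    "distr r (borel2_of_omet Y) (\<lambda>z. (f (fst z), f (snd z)))
      \<in> couplings Y (distr p (borel_of_omet Y) f) (distr q (borel_of_omet Y) f)"
proof -
  note R = X.couplingD[OF r]
  have fm: "f \<in> borel_of_omet X \<rightarrow>\<^sub>M borel_of_omet Y"
    by (rule short_map_measurable[OF X.metric_omet_axioms Y.metric_omet_axioms short])
  show m: "(\<lambda>z. (f (fst z), f (snd z))) \<in> r \<rightarrow>\<^sub>M borel2_of_omet Y"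
    using continuous_map_measurable_borel_on[OF short_prod_continuous[OF X.metric_omet_axioms Y.metric_omet_axioms short short]]
      measurable_cong_sets[OF R(3) refl] by blast
  show "distr r (borel2_of_omet Y) (\<lambda>z. (f (fst z), f (snd z)))
      \<in> couplings Y (distr p (borel_of_omet Y) f) (distr q (borel_of_omet Y) f)"
    unfolding couplings_def
  proof (intro CollectI conjI)
    show "prob_space (distr r (borel2_of_omet Y) (\<lambda>z. (f (fst z), f (snd z))))"
      by (rule prob_space.prob_space_distr[OF R(1) m])
    have "distr p (borel_of_omet Y) f = distr r (borel_of_omet Y) (\<lambda>z. f (fst z))"
      unfolding R(4)[symmetric] by (subst distr_distr[OF fm R(6)]) (simp add: o_def)
    then show "distr (distr r (borel2_of_omet Y) (\<lambda>z. (f (fst z), f (snd z)))) (borel_of_omet Y) fst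
        = distr p (borel_of_omet Y) f"
      by (subst distr_distr[OF Y.fst_borel2 m]) (simp add: o_def)
    have "distr q (borel_of_omet Y) f = distr r (borel_of_omet Y) (\<lambda>z. f (snd z))"
      unfolding R(5)[symmetric] by (subst distr_distr[OF fm R(7)]) (simp add: o_def)
    then show "distr (distr r (borel2_of_omet Y) (\<lambda>z. (f (fst z), f (snd z)))) (borel_of_omet Y) snd
        = distr q (borel_of_omet Y) f"
      by (subst distr_distr[OF Y.snd_borel2 m]) (simp add: o_def)
  qed simp_all
qed

lemma P_map_short: "short_map (P_obj X) (P_obj Y) (P_map X Y f)"
  unfolding short_map_def pts_P_obj dst_P_obj
proof (intro conjI ballI)
  show "P_map X Y f \<in> P_pts X \<rightarrow> P_pts Y" using P_map_P_pts by blast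
  fix p q assume p: "p \<in> P_pts X" and q: "q \<in> P_pts X"
  show "P_dst Y (P_map X Y f p) (P_map X Y f q) \<le> P_dst X p q"
  proof (rule X.P_dst_ge[OF p q])
    fix r assume r: "r \<in> couplings X p q"
    note R = X.couplingD[OF r] and D = distr_coupling[OF r]
    have "P_dst Y (P_map X Y f p) (P_map X Y f q)
        \<le> (\<integral>z. dst Y (fst z) (snd z) \<partial>distr r (borel2_of_omet Y) (\<lambda>z. (f (fst z), f (snd z))))"
      unfolding P_map_eq[OF p] P_map_eq[OF q]
      by (rule Y.P_dst_le[OF D(2) distr_P_pts[OF p] distr_P_pts[OF q]])
    also have "\<dots> = (\<integral>z. dst Y (f (fst z)) (f (snd z)) \<partial>r)"
      by (subst integral_distr[OF D(1) Y.measurable_dst]) simp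
    also have "\<dots> \<le> (\<integral>z. dst X (fst z) (snd z) \<partial>r)"
    proof (rule integral_mono)
      show "integrable r (\<lambda>z. dst Y (f (fst z)) (f (snd z)))"
        using Y.coupling_integrable_dst[OF D(2) distr_P_pts[OF p] distr_P_pts[OF q]]
          integrable_distr_eq[OF D(1) Y.measurable_dst] by simp
      show "integrable r (\<lambda>z. dst X (fst z) (snd z))" by (rule X.coupling_integrable_dst[OF r p q])
      fix z assume "z \<in> space r"
      then have "fst z \<in> pts X" "snd z \<in> pts X" unfolding R(2) by (simp_all add: mem_Times_iff)
      then show "dst Y (f (fst z)) (f (snd z)) \<le> dst X (fst z) (snd z)"
        using short unfolding short_map_def by blast
    qed
    finally show "P_dst Y (P_map X Y f p) (P_map X Y f q) \<le> (\<integral>z. dst X (fst z) (snd z) \<partial>r)" .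
  qed
qed

end

lemma ordered_metric_spaceD:
  assumes "ordered_metric_space X"
  shows "metric_omet X" "leq X \<in> sets (borel2_of_omet X)" "leq X \<subseteq> pts X \<times> pts X"
    "\<And>x. x \<in> pts X \<Longrightarrow> (x, x) \<in> leq X" "trans (leq X)" "antisym (leq X)"
  using assms closedin_borel_on
  by (auto simp: ordered_metric_space_def metric_omet_def partial_order_on_def preorder_on_def refl_on_def)

lemma P_map_mono:
  assumes "ordered_metric_space X" "ordered_metric_space Y" and f: "short_map X Y f" "monotone_map X Y f"
  shows "monotone_map (P_obj X) (P_obj Y) (P_map X Y f)"
  unfolding monotone_map_def leq_P_obj
proof safe
  note OX = ordered_metric_spaceD[OF assms(1)] and OY = ordered_metric_spaceD[OF assms(2)]
  interpret short_omet X Y f using OX(1) OY(1) f(1) by (simp add: short_omet_def short_omet_axioms_def)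
  fix p q assume "(p, q) \<in> P_leq X"
  then obtain r where p: "p \<in> P_pts X" and q: "q \<in> P_pts X" and r: "r \<in> couplings X p q" "measure r (leq X) = 1"
    by (auto simp: P_leq_def)
  note R = X.couplingD[OF r(1)] and D = distr_coupling[OF r(1)]
  interpret r: prob_space r by (rule R(1))
  interpret r': prob_space "distr r (borel2_of_omet Y) (\<lambda>z. (f (fst z), f (snd z)))" by (rule X.couplingD(1) Y.couplingD(1), rule D(2))
  have "1 = measure r (leq X)" using r(2) by simp
  also have "\<dots> \<le> measure r ((\<lambda>z. (f (fst z), f (snd z))) -` leq Y \<inter> space r)"
    using f(2) OX(3) measurable_sets[OF D(1) OY(2)]
    by (intro r.finite_measure_mono) (auto simp: R(2) monotone_map_def)
  also have "\<dots> = measure (distr r (borel2_of_omet Y) (\<lambda>z. (f (fst z), f (snd z)))) (leq Y)"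
    by (rule measure_distr[OF D(1) OY(2), symmetric])
  finally have "measure (distr r (borel2_of_omet Y) (\<lambda>z. (f (fst z), f (snd z)))) (leq Y) = 1"
    using r'.prob_le_1 by (intro antisym)
  then show "(P_map X Y f p, P_map X Y f q) \<in> P_leq Y"
    using D(2) distr_P_pts[OF p] distr_P_pts[OF q] unfolding P_leq_def P_map_eq[OF p] P_map_eq[OF q] by blast
qed

lemma P_map_pointwise_mono:
  assumes "metric_omet X" "ordered_metric_space Y" and f: "short_map X Y f" and g: "short_map X Y g"
    and le: "\<And>x. x \<in> pts X \<Longrightarrow> (f x, g x) \<in> leq Y" and p: "p \<in> P_pts X"
  shows "(P_map X Y f p, P_map X Y g p) \<in> P_leq Y"
proof -
  note OY = ordered_metric_spaceD[OF assms(2)]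
  interpret f: short_omet X Y f using assms(1) OY(1) f by (simp add: short_omet_def short_omet_axioms_def)
  interpret g: short_omet X Y g using assms(1) OY(1) g by (simp add: short_omet_def short_omet_axioms_def)
  interpret p: prob_space p by (rule f.X.P_ptsD(1)[OF p])
  have "continuous_map (top_of X) (prod_topology (top_of Y) (top_of Y)) (\<lambda>x. (f x, g x))"
    by (intro continuous_map_pairedI short_map_continuous assms(1) OY(1) f g)
  then have m: "(\<lambda>x. (f x, g x)) \<in> p \<rightarrow>\<^sub>M borel2_of_omet Y"
    using continuous_map_measurable_borel_on measurable_cong_sets[OF f.X.P_ptsD(3)[OF p] refl] by blast
  define r where "r = distr p (borel2_of_omet Y) (\<lambda>x. (f x, g x))"
  have "r \<in> couplings Y (P_map X Y f p) (P_map X Y g p)"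
    unfolding couplings_def r_def f.P_map_eq[OF p] g.P_map_eq[OF p]
  proof (intro CollectI conjI)
    show "prob_space (distr p (borel2_of_omet Y) (\<lambda>x. (f x, g x)))" by (rule p.prob_space_distr[OF m])
    show "distr (distr p (borel2_of_omet Y) (\<lambda>x. (f x, g x))) (borel_of_omet Y) fst = distr p (borel_of_omet Y) f"
      by (subst distr_distr[OF f.Y.fst_borel2 m]) (simp add: o_def)
    show "distr (distr p (borel2_of_omet Y) (\<lambda>x. (f x, g x))) (borel_of_omet Y) snd = distr p (borel_of_omet Y) g"
      by (subst distr_distr[OF f.Y.snd_borel2 m]) (simp add: o_def)
  qed simp_all
  moreover have "measure r (leq Y) = 1"
  proof -
    have "(\<lambda>x. (f x, g x)) -` leq Y \<inter> space p = space p"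
      using le f.X.P_ptsD(2)[OF p] by auto
    then show ?thesis unfolding r_def measure_distr[OF m OY(2)] by (simp add: p.prob_space)
  qed
  ultimately show ?thesis
    using f.P_map_P_pts[OF p] g.P_map_P_pts[OF p] unfolding P_leq_def by blast
qed

section \<open>Dirac measures and the unit\<close>

context metric_omet begin

lemma P_unit_eq: "x \<in> pts X \<Longrightarrow> P_unit X x = return (borel_of_omet X) x"
  by (simp add: P_unit_def)

lemma integral_P_unit:
  assumes "x \<in> pts X" "short_map X real_line f"
  shows "(\<integral>y. f y \<partial>P_unit X x) = f x"
  using assms short_real_measurable[OF assms(2)] by (simp add: P_unit_eq integral_return)

lemma P_unit_P_pts:
  assumes x: "x \<in> pts X"
  shows "P_unit X x \<in> P_pts X"
proof -
  have "integrable (return (borel_of_omet X) x) f" if f: "short_map X real_line f" for f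
  proof (rule integrableI_bounded)
    show "f \<in> borel_measurable (return (borel_of_omet X) x)" using short_real_measurable[OF f] by simp
    show "(\<integral>\<^sup>+ y. ennreal (norm (f y)) \<partial>return (borel_of_omet X) x) < \<infinity>"
      using x short_real_measurable[OF f] by (subst nn_integral_return) auto
  qed
  moreover have "radon_prob X (return (borel_of_omet X) x)"
    unfolding radon_prob_def
  proof (intro conjI ballI)
    show "prob_space (return (borel_of_omet X) x)" using x by (intro prob_space_return) simp
    fix B assume "B \<in> sets (return (borel_of_omet X) x)"
    then have B: "B \<in> sets (borel_of_omet X)" by simp
    show "emeasure (return (borel_of_omet X) x) B
        = (SUP K\<in>{K. compactin (top_of X) K \<and> K \<subseteq> B}. emeasure (return (borel_of_omet X) x) K)"
    proof (rule antisym)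
      show "(SUP K\<in>{K. compactin (top_of X) K \<and> K \<subseteq> B}. emeasure (return (borel_of_omet X) x) K)
          \<le> emeasure (return (borel_of_omet X) x) B"
        using B by (intro SUP_least emeasure_mono) auto
      show "emeasure (return (borel_of_omet X) x) B
          \<le> (SUP K\<in>{K. compactin (top_of X) K \<and> K \<subseteq> B}. emeasure (return (borel_of_omet X) x) K)"
      proof (cases "x \<in> B")
        case True
        have c: "compactin (top_of X) {x}" using x by (simp add: finite_imp_compactin)
        then have "closedin (top_of X) {x}"
          unfolding top_of_eq by (rule compactin_imp_closedin[OF Hausdorff_space_mtopology])
        then have "{x} \<in> sets (borel_of_omet X)" by (rule closedin_borel_on)
        then have "emeasure (return (borel_of_omet X) x) B = emeasure (return (borel_of_omet X) x) {x}"
          using B True by simp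
        also have "\<dots> \<le> (SUP K\<in>{K. compactin (top_of X) K \<and> K \<subseteq> B}. emeasure (return (borel_of_omet X) x) K)"
          using c True by (intro SUP_upper) auto
        finally show ?thesis .
      qed (use B in simp)
    qed
  qed simp_all
  ultimately show ?thesis using x by (simp add: P_unit_eq P_pts_def finite_first_moment_def)
qed

text \<open>One coupling for both properties of the unit: its cost is \<open>dst X x y\<close>, and
  it gives \<open>leq X\<close> full mass as soon as \<open>(x, y) \<in> leq X\<close>.\<close>

lemma return_coupling:
  assumes x: "x \<in> pts X" and y: "y \<in> pts X"
  shows "return (borel2_of_omet X) (x, y) \<in> couplings X (P_unit X x) (P_unit X y)"
  using assms prob_space_return[of "(x, y)" "borel2_of_omet X"]
    distr_return[OF fst_borel2, of "(x, y)"] distr_return[OF snd_borel2, of "(x, y)"]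
  unfolding couplings_def by (simp add: P_unit_eq)

lemma P_unit_short: "short_map X (P_obj X) (P_unit X)"
  unfolding short_map_def pts_P_obj dst_P_obj
proof (intro conjI ballI)
  show "P_unit X \<in> pts X \<rightarrow> P_pts X" using P_unit_P_pts by blast
  fix x y assume x: "x \<in> pts X" and y: "y \<in> pts X"
  have "P_dst X (P_unit X x) (P_unit X y) \<le> (\<integral>z. dst X (fst z) (snd z) \<partial>return (borel2_of_omet X) (x, y))"
    by (rule P_dst_le[OF return_coupling[OF x y] P_unit_P_pts[OF x] P_unit_P_pts[OF y]])
  also have "\<dots> = dst X x y"
    using x y by (subst integral_return[OF _ measurable_dst]) simp_all
  finally show "P_dst X (P_unit X x) (P_unit X y) \<le> dst X x y" .
qed

end

lemma P_unit_mono: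
  assumes "ordered_metric_space X"
  shows "monotone_map X (P_obj X) (P_unit X)"
  unfolding monotone_map_def leq_P_obj
proof safe
  note O = ordered_metric_spaceD[OF assms]
  interpret metric_omet X by (rule O(1))
  fix x y assume xy: "(x, y) \<in> leq X"
  then have x: "x \<in> pts X" and y: "y \<in> pts X" using O(3) by auto
  have "measure (return (borel2_of_omet X) (x, y)) (leq X) = 1"
    using xy O(2) by (simp add: measure_return)
  then show "(P_unit X x, P_unit X y) \<in> P_leq X"
    using return_coupling[OF x y] P_unit_P_pts[OF x] P_unit_P_pts[OF y] unfolding P_leq_def by blast
qed

context short_omet begin

lemma P_map_P_unit:
  assumes x: "x \<in> pts X"
  shows "P_map X Y f (P_unit X x) = P_unit Y (f x)"
proof -
  have "f x \<in> pts Y" using short x by (auto simp: short_map_def)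
  then show ?thesis
    using x distr_return[OF short_map_measurable[OF X.metric_omet_axioms Y.metric_omet_axioms short], of x]
    unfolding P_map_eq[OF X.P_unit_P_pts[OF x]] by (simp add: X.P_unit_eq Y.P_unit_eq)
qed

end

text \<open>\<open>h\<close> only has to agree with the composite on the carrier, because morphisms
  are extensional and a composite built with \<open>compose\<close> may differ elsewhere from
  \<open>\<lambda>x. g (f x)\<close>.\<close>

lemma P_map_comp:
  assumes "metric_omet X" "metric_omet Y" "metric_omet Z" and f: "short_map X Y f" and g: "short_map Y Z g"
    and h: "\<And>x. x \<in> pts X \<Longrightarrow> h x = g (f x)" and p: "p \<in> P_pts X"
  shows "P_map Y Z g (P_map X Y f p) = P_map X Z h p"
proof -
  interpret f: short_omet X Y f using assms by (simp add: short_omet_def short_omet_axioms_def)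
  interpret g: short_omet Y Z g using assms by (simp add: short_omet_def short_omet_axioms_def)
  have "P_map Y Z g (P_map X Y f p) = distr (distr p (borel_of_omet Y) f) (borel_of_omet Z) g"
    using f.P_map_eq[OF p] g.P_map_eq[OF f.P_map_P_pts[OF p]] by simp
  also have "\<dots> = distr p (borel_of_omet Z) (\<lambda>x. g (f x))"
    by (subst distr_distr[OF short_map_measurable[OF assms(2,3) g] f.measurable_P_pts[OF p]]) (simp add: o_def)
  also have "\<dots> = distr p (borel_of_omet Z) h"
    by (rule distr_cong) (simp_all add: h f.X.P_ptsD(2)[OF p])
  finally show ?thesis using p by (simp add: P_map_def)
qed

section \<open>Averages\<close>

context metric_omet begin

text \<open>Turns a test function on \<open>X\<close> into a test function on
  \<open>P_obj X\<close>, so that finite first moment of a measure on \<open>P_obj X\<close>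
  supplies its integrability and measurability.\<close>

lemma integral_functional_short:
  assumes "short_map X real_line f"
  shows "short_map (P_obj X) real_line (\<lambda>p. \<integral>x. f x \<partial>p)"
  unfolding short_real_iff pts_P_obj dst_P_obj
  using short_integral_diff_le assms by blast

text \<open>Every value of \<open>P_avg\<close> is computed this way; the description is unique
  because short integrals determine the measure.\<close>

lemma P_avg_eqI:
  assumes \<mu>: "\<mu> \<in> P_pts (P_obj X)" and q: "q \<in> P_pts X"
    and int: "\<And>f. short_map X real_line f \<Longrightarrow> (\<integral>x. f x \<partial>q) = (\<integral>p. (\<integral>x. f x \<partial>p) \<partial>\<mu>)"
  shows "P_avg X \<mu> = q"
proof -
  have "(THE q. q \<in> P_pts X \<and> (\<forall>f. short_map X real_line f \<longrightarrow>
           (\<integral>x. f x \<partial>q) = (\<integral>p. (\<integral>x. f x \<partial>p) \<partial>\<mu>))) = q"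
  proof (rule the_equality)
    fix q' assume q': "q' \<in> P_pts X \<and> (\<forall>f. short_map X real_line f \<longrightarrow>
           (\<integral>x. f x \<partial>q') = (\<integral>p. (\<integral>x. f x \<partial>p) \<partial>\<mu>))"
    then have "q' \<in> P_pts X" ..
    show "q' = q"
      by (rule prob_eq_if_short_integrals_eq[OF P_ptsD(1,3)[OF \<open>q' \<in> P_pts X\<close>] P_ptsD(1,3)[OF q]])
        (use q' int in simp)
  qed (use q int in simp)
  then show ?thesis using \<mu> by (simp add: P_avg_def)
qed

lemma short_max: "short_map X real_line f \<Longrightarrow> short_map X real_line (\<lambda>x. max a (f x))"
  unfolding short_real_iff by (smt (verit, best))

lemma short_min: "short_map X real_line f \<Longrightarrow> short_map X real_line (\<lambda>x. min a (f x))"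
  unfolding short_real_iff by (smt (verit, best))

lemma short_uminus: "short_map X real_line f \<Longrightarrow> short_map X real_line (\<lambda>x. - f x)"
  unfolding short_real_iff by (smt (verit, best))

text \<open>The mean in the sense of the Giry monad, available before anything is known about
  regularity. In a complete space it turns out to be the measure that \<open>P_avg\<close>
  describes.\<close>

definition avg :: "'a measure measure \<Rightarrow> 'a measure" where
  "avg \<mu> = \<mu> \<bind> (\<lambda>p. p)"

context
  fixes \<mu> assumes \<mu>: "\<mu> \<in> P_pts (P_obj X)"
begin

interpretation P: metric_omet "P_obj X" by (rule metric_omet_P_obj[OF metric_omet_axioms])

lemma mu_space: "space \<mu> = P_pts X" and mu_prob: "prob_space \<mu>"
  using P.P_ptsD[OF \<mu>] by simp_all

lemma integrable_functional:
  "short_map X real_line f \<Longrightarrow> integrable \<mu> (\<lambda>p. \<integral>x. f x \<partial>p)"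
  by (rule P.P_ptsD(5)[OF \<mu> integral_functional_short])

text \<open>\<open>\<mu>\<close> lives on the Borel sets of the Kantorovich metric, whereas a bind
  asks for measurability of evaluation at Borel sets of \<open>X\<close>. Closed sets suffice, and
  there the mass is a pointwise limit of multiples of short functionals by
  \<open>closed_measure_limit\<close>.\<close>

lemma kernel_measurable: "(\<lambda>p. p) \<in> \<mu> \<rightarrow>\<^sub>M prob_algebra (borel_of_omet X)"
proof (rule measurable_prob_algebra_generated)
  show "sets (borel_of_omet X) = sigma_sets (pts X) {C. closedin (top_of X) C}"
    using sets_borel_on_closed[of "top_of X"] by simp
  show "Int_stable {C. closedin (top_of X) C}" by (auto simp: Int_stable_def)
  show "{C. closedin (top_of X) C} \<subseteq> Pow (pts X)" using closedin_subset[of "top_of X"] by auto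
  fix p assume "p \<in> space \<mu>"
  then have p: "p \<in> P_pts X" by (simp add: mu_space)
  show "prob_space p" "sets p = sets (borel_of_omet X)" using P_ptsD[OF p] by simp_all
next
  fix C assume "C \<in> {C. closedin (top_of X) C}"
  then have C: "closedin (top_of X) C" by simp
  show "(\<lambda>p. emeasure p C) \<in> borel_measurable \<mu>"
  proof (cases "C = {}")
    case False
    have CX: "C \<subseteq> pts X" using closedin_subset[OF C] by simp
    have "(\<lambda>p. measure p C) \<in> borel_measurable \<mu>"
    proof (rule borel_measurable_LIMSEQ_real)
      show "(\<lambda>n. real (Suc n) * (\<integral>x. max 0 (1 / real (Suc n) - set_dst X C x) \<partial>p)) \<longlonglongrightarrow> measure p C"
        if "p \<in> space \<mu>" for p
        using that P_ptsD[of p] by (intro closed_measure_limit[OF _ _ C False]) (simp_all add: mu_space)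
      show "(\<lambda>p. real (Suc n) * (\<integral>x. max 0 (1 / real (Suc n) - set_dst X C x) \<partial>p)) \<in> borel_measurable \<mu>" for n
        by (intro borel_measurable_times borel_measurable_const
            borel_measurable_integrable integrable_functional short_max_diff set_dst_short False CX)
    qed
    then have "(\<lambda>p. ennreal (measure p C)) \<in> borel_measurable \<mu>" by simp
    moreover have "emeasure p C = ennreal (measure p C)" if "p \<in> space \<mu>" for p
    proof -
      interpret prob_space p using that P_ptsD(1)[of p] by (simp add: mu_space)
      show ?thesis by (rule emeasure_eq_measure)
    qed
    ultimately show ?thesis by (subst measurable_cong)
  qed simp
qed

lemma kernel_measurable_sub: "(\<lambda>p. p) \<in> \<mu> \<rightarrow>\<^sub>M subprob_algebra (borel_of_omet X)"
  by (rule measurable_prob_algebraD[OF kernel_measurable])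

lemma avg_prob: "prob_space (avg \<mu>)" and avg_sets: "sets (avg \<mu>) = sets (borel_of_omet X)"
proof -
  have ne: "space \<mu> \<noteq> {}" by (rule prob_space.not_empty[OF mu_prob])
  show "sets (avg \<mu>) = sets (borel_of_omet X)"
    unfolding avg_def using P_ptsD(3) ne by (intro sets_bind) (auto simp: mu_space)
  show "prob_space (avg \<mu>)"
    unfolding avg_def using P_ptsD(1)
    by (intro prob_space.prob_space_bind[OF mu_prob _ kernel_measurable_sub] AE_I2) (simp add: mu_space)
qed

text \<open>Nonnegative functions come first because the integral over a bind splits for them
  without prior integrability over \<open>avg \<mu>\<close>; that integrability then follows, as the
  right-hand side is finite.\<close>

lemma avg_nn_integral:
  assumes f: "short_map X real_line f" and nn: "\<And>x. x \<in> pts X \<Longrightarrow> 0 \<le> f x"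
  shows "(\<integral>\<^sup>+x. ennreal (f x) \<partial>avg \<mu>) = ennreal (\<integral>p. (\<integral>x. f x \<partial>p) \<partial>\<mu>)"
proof -
  have fm: "(\<lambda>x. ennreal (f x)) \<in> borel_measurable (borel_of_omet X)"
    using short_real_measurable[OF f] by simp
  have "(\<integral>\<^sup>+x. ennreal (f x) \<partial>avg \<mu>) = (\<integral>\<^sup>+p. \<integral>\<^sup>+x. ennreal (f x) \<partial>p \<partial>\<mu>)"
    unfolding avg_def by (rule nn_integral_bind[OF fm kernel_measurable_sub])
  also have "\<dots> = (\<integral>\<^sup>+p. ennreal (\<integral>x. f x \<partial>p) \<partial>\<mu>)"
  proof (rule nn_integral_cong)
    fix p assume "p \<in> space \<mu>"
    then have p: "p \<in> P_pts X" by (simp add: mu_space)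
    show "(\<integral>\<^sup>+x. ennreal (f x) \<partial>p) = ennreal (\<integral>x. f x \<partial>p)"
      by (rule nn_integral_eq_integral[OF P_ptsD(5)[OF p f] AE_I2]) (simp add: P_ptsD(2)[OF p] nn)
  qed
  also have "\<dots> = ennreal (\<integral>p. (\<integral>x. f x \<partial>p) \<partial>\<mu>)"
  proof (rule nn_integral_eq_integral[OF integrable_functional[OF f] AE_I2])
    fix p assume "p \<in> space \<mu>"
    then have p: "p \<in> P_pts X" by (simp add: mu_space)
    show "0 \<le> (\<integral>x. f x \<partial>p)" by (intro integral_nonneg_AE AE_I2) (simp add: P_ptsD(2)[OF p] nn)
  qed
  finally show ?thesis .
qed

lemma avg_integral_nonneg:
  assumes f: "short_map X real_line f" and nn: "\<And>x. x \<in> pts X \<Longrightarrow> 0 \<le> f x"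
  shows "integrable (avg \<mu>) f" "(\<integral>x. f x \<partial>avg \<mu>) = (\<integral>p. (\<integral>x. f x \<partial>p) \<partial>\<mu>)"
proof -
  have sp: "space (avg \<mu>) = pts X" using sets_eq_imp_space_eq[OF avg_sets] by simp
  have fm: "f \<in> borel_measurable (avg \<mu>)"
    using short_real_measurable[OF f] measurable_cong_sets[OF avg_sets refl] by blast
  have ae: "AE x in avg \<mu>. 0 \<le> f x" using nn sp by (intro AE_I2) simp
  show i: "integrable (avg \<mu>) f"
    by (rule integrableI_nn_integral_finite[OF fm ae avg_nn_integral[OF f nn]])
  have "0 \<le> (\<integral>p. (\<integral>x. f x \<partial>p) \<partial>\<mu>)"
    using nn P_ptsD(2) by (intro integral_nonneg_AE AE_I2) (simp add: mu_space)
  then show "(\<integral>x. f x \<partial>avg \<mu>) = (\<integral>p. (\<integral>x. f x \<partial>p) \<partial>\<mu>)"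
    using integral_eq_nn_integral[OF fm ae] avg_nn_integral[OF f nn] by simp
qed

text \<open>The positive and negative parts of a short function are short, so the nonnegative case
  applies to each.\<close>

lemma avg_integral:
  assumes f: "short_map X real_line f"
  shows "integrable (avg \<mu>) f" "(\<integral>x. f x \<partial>avg \<mu>) = (\<integral>p. (\<integral>x. f x \<partial>p) \<partial>\<mu>)"
proof -
  let ?g = "\<lambda>x. max 0 (f x)" and ?h = "\<lambda>x. max 0 (- f x)"
  have g: "short_map X real_line ?g" by (rule short_max[OF f])
  have h: "short_map X real_line ?h" by (rule short_max[OF short_uminus[OF f]])
  have eq: "f = (\<lambda>x. ?g x - ?h x)" by (auto simp: max_def)
  note G = avg_integral_nonneg[OF g] and H = avg_integral_nonneg[OF h]
  show "integrable (avg \<mu>) f"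
    by (subst eq, rule Bochner_Integration.integrable_diff) (intro G H; simp)+
  have "(\<integral>x. f x \<partial>avg \<mu>) = (\<integral>x. ?g x \<partial>avg \<mu>) - (\<integral>x. ?h x \<partial>avg \<mu>)"
    by (subst eq, rule Bochner_Integration.integral_diff) (intro G H; simp)+
  also have "\<dots> = (\<integral>p. (\<integral>x. ?g x \<partial>p) \<partial>\<mu>) - (\<integral>p. (\<integral>x. ?h x \<partial>p) \<partial>\<mu>)"
    by (subst G(2), simp, subst H(2), simp, rule refl)
  also have "\<dots> = (\<integral>p. (\<integral>x. ?g x \<partial>p) - (\<integral>x. ?h x \<partial>p) \<partial>\<mu>)"
    by (rule Bochner_Integration.integral_diff[symmetric]; rule integrable_functional; fact g h)
  also have "\<dots> = (\<integral>p. (\<integral>x. f x \<partial>p) \<partial>\<mu>)"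
  proof (rule Bochner_Integration.integral_cong[OF refl])
    fix p assume "p \<in> space \<mu>"
    then have p: "p \<in> P_pts X" by (simp add: mu_space)
    show "(\<integral>x. ?g x \<partial>p) - (\<integral>x. ?h x \<partial>p) = (\<integral>x. f x \<partial>p)"
      by (subst (3) eq, rule Bochner_Integration.integral_diff[symmetric]; rule P_ptsD(5)[OF p]; fact g h)
  qed
  finally show "(\<integral>x. f x \<partial>avg \<mu>) = (\<integral>p. (\<integral>x. f x \<partial>p) \<partial>\<mu>)" .
qed

text \<open>
  The points \<open>p\<close> close to a given one in the sense that the short function \<open>min \<delta> (d(-, N))\<close> has
  small integral form an open set, and by Markov's inequality they have \<open>N\<close> as a common net.
\<close>

lemma uniform_net:
  assumes e: "\<epsilon> > 0" and d: "\<delta> > 0" and K: "compactin (top_of (P_obj X)) K"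
  obtains N where "finite N" "N \<subseteq> pts X" "\<And>p. p \<in> K \<Longrightarrow> measure p (pts X - (\<Union>a\<in>N. mball a \<delta>)) \<le> \<epsilon>"
proof -
  have KP: "K \<subseteq> P_pts X" using compactin_subset_topspace[OF K] by simp
  \<comment> \<open>A third, so that the bound obtained below is two thirds of
    \<open>\<delta> * \<epsilon>\<close>. It has to be strictly smaller than
    \<open>\<delta> * \<epsilon>\<close>, as \<open>p\<close> must lie in the open set
    \<open>U p\<close>.\<close>
  define \<eta> where "\<eta> = \<delta> * \<epsilon> / 3"
  have \<eta>: "\<eta> > 0" using e d by (simp add: \<eta>_def)
  have "\<exists>N. finite N \<and> N \<noteq> {} \<and> N \<subseteq> pts X \<and> (\<integral>x. min \<delta> (set_dst X N x) \<partial>p) < \<delta> * \<epsilon>" if p: "p \<in> P_pts X" for p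
  proof -
    interpret prob_space p by (rule P_ptsD(1)[OF p])
    note sp = P_ptsD(2,3)[OF p]
    obtain x0 where x0: "x0 \<in> pts X" using P_ptsD(6)[OF p] by blast
    obtain M where M: "finite M" "M \<subseteq> pts X" "measure p (\<Union>a\<in>M. mball a \<eta>) > 1 - \<epsilon> / 3"
      using radon_finite_net[OF P_ptsD(4)[OF p], of "\<epsilon> / 3" \<eta>] \<eta> e by auto
    \<comment> \<open>\<open>x0\<close> keeps the net nonempty, since \<open>set_dst\<close> of the
      empty set is meaningless.\<close>
    let ?N = "insert x0 M" and ?B = "\<Union>a\<in>M. mball a \<eta>"
    have N: "finite ?N" "?N \<noteq> {}" "?N \<subseteq> pts X" using M x0 by auto
    have B: "?B \<in> sets p" unfolding sp(2) using M(1) by (intro sets.finite_UN ball_borel)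
    have "(\<integral>x. min \<delta> (set_dst X ?N x) \<partial>p) \<le> (\<integral>x. \<eta> + \<delta> * indicator (space p - ?B) x \<partial>p)"
    proof (rule integral_mono)
      show "integrable p (\<lambda>x. min \<delta> (set_dst X ?N x))"
        by (rule P_ptsD(5)[OF p short_min[OF set_dst_short[OF N(2,3)]]])
      show "integrable p (\<lambda>x. \<eta> + \<delta> * indicator (space p - ?B) x)"
        using B by (intro Bochner_Integration.integrable_add integrable_mult_right integrable_const integrable_real_indicator)
          (auto simp: emeasure_eq_measure)
      fix x assume x: "x \<in> space p"
      show "min \<delta> (set_dst X ?N x) \<le> \<eta> + \<delta> * indicator (space p - ?B) x"
      proof (cases "x \<in> ?B")
        case True
        then obtain a where a: "a \<in> M" "x \<in> mball a \<eta>" by blast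
        then have "set_dst X ?N x \<le> \<eta>" using set_dst_le[of a ?N x] commute[of x a] by auto
        then show ?thesis using True by simp
      next
        case False
        then show ?thesis using x \<eta> by simp
      qed
    qed
    also have "\<dots> = \<eta> + \<delta> * measure p (space p - ?B)"
      using B by (subst Bochner_Integration.integral_add) (auto simp: prob_space emeasure_eq_measure)
    also have "\<dots> \<le> \<eta> + \<delta> * (\<epsilon> / 3)"
      using M(3) prob_compl[OF B] d by simp
    also have "\<dots> < \<delta> * \<epsilon>" using e d by (simp add: \<eta>_def)
    finally show ?thesis using N by blast
  qed
  then obtain N where N: "\<And>p. p \<in> P_pts X \<Longrightarrow> finite (N p) \<and> N p \<noteq> {} \<and> N p \<subseteq> pts X \<and>
      (\<integral>x. min \<delta> (set_dst X (N p) x) \<partial>p) < \<delta> * \<epsilon>" by metis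
  define U where "U p = {p' \<in> P_pts X. (\<integral>x. min \<delta> (set_dst X (N p) x) \<partial>p') < \<delta> * \<epsilon>}" for p
  have U: "openin (top_of (P_obj X)) (U p)" if p: "p \<in> P_pts X" for p
  proof -
    have "short_map (P_obj X) real_line (\<lambda>p'. \<integral>x. min \<delta> (set_dst X (N p) x) \<partial>p')"
      using N[OF p] by (intro integral_functional_short short_min set_dst_short) auto
    then have c: "continuous_map (top_of (P_obj X)) euclidean (\<lambda>p'. \<integral>x. min \<delta> (set_dst X (N p) x) \<partial>p')"
      using short_map_continuous[OF P.metric_omet_axioms metric_omet_real_line] by simp
    show ?thesis unfolding U_def
      using openin_continuous_map_preimage[OF c, of "{..<\<delta> * \<epsilon>}"] by simp
  qed
  \<comment> \<open>Finitely many sets \<open>U p\<close> cover \<open>K\<close>; the union of their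
    nets then works for every point of \<open>K\<close>.\<close>
  have "\<exists>\<F>. finite \<F> \<and> \<F> \<subseteq> U ` K \<and> K \<subseteq> \<Union>\<F>"
  proof (rule compactinD[OF K])
    show "\<And>V. V \<in> U ` K \<Longrightarrow> openin (top_of (P_obj X)) V" using U KP by blast
    show "K \<subseteq> \<Union> (U ` K)" using N KP unfolding U_def by blast
  qed
  then obtain F where F: "finite F" "F \<subseteq> K" "K \<subseteq> (\<Union>p\<in>F. U p)"
    by (metis finite_subset_image)
  have fin: "finite (\<Union>p\<in>F. N p)" using F N KP by blast
  have sub: "(\<Union>p\<in>F. N p) \<subseteq> pts X" using F N KP by blast
  have "measure p (pts X - (\<Union>a\<in>(\<Union>p\<in>F. N p). mball a \<delta>)) \<le> \<epsilon>" if pK: "p \<in> K" for p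
  proof -
    have p: "p \<in> P_pts X" using pK KP by blast
    interpret prob_space p by (rule P_ptsD(1)[OF p])
    note sp = P_ptsD(2,3)[OF p]
    obtain p0 where p0: "p0 \<in> F" "p \<in> U p0" using subsetD[OF F(3) pK] by (elim UN_E)
    have N0: "finite (N p0)" "N p0 \<noteq> {}" "N p0 \<subseteq> pts X" using N[of p0] p0(1) F(2) KP by auto
    let ?g = "\<lambda>x. min \<delta> (set_dst X (N p0) x)"
    let ?A = "pts X - (\<Union>a\<in>(\<Union>p\<in>F. N p). mball a \<delta>)"
    have "(\<Union>a\<in>(\<Union>p\<in>F. N p). mball a \<delta>) \<in> sets p" unfolding sp(2) using fin by (intro sets.finite_UN ball_borel)
    then have A: "?A \<in> sets p" using sets.compl_sets[of _ p] sp(1) by simp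
    have "\<delta> * measure p ?A = (\<integral>x. \<delta> * indicator ?A x \<partial>p)" using A by simp
    also have "\<dots> \<le> (\<integral>x. ?g x \<partial>p)"
    proof (rule integral_mono)
      show "integrable p ?g" by (rule P_ptsD(5)[OF p short_min[OF set_dst_short[OF N0(2,3)]]])
      show "integrable p (\<lambda>x. \<delta> * indicator ?A x)"
        using A by (intro integrable_mult_right integrable_real_indicator) (auto simp: emeasure_eq_measure)
      fix x assume x: "x \<in> space p"
      show "\<delta> * indicator ?A x \<le> ?g x"
      proof (cases "x \<in> ?A")
        case True
        have "\<not> dst X x a < \<delta>" if a: "a \<in> N p0" for a
        proof
          assume "dst X x a < \<delta>"
          then have "x \<in> mball a \<delta>" using a N0(3) x sp(1) commute[of x a] by auto
          then show False using True a p0(1) by blast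
        qed
        then have "\<delta> \<le> set_dst X (N p0) x" using set_dst_less_iff[OF N0(2), of x \<delta>] by (meson not_le)
        then show ?thesis using True by simp
      next
        case False
        then show ?thesis using set_dst_nonneg[OF N0(2), of x] d by simp
      qed
    qed
    also have "\<dots> \<le> \<delta> * \<epsilon>" using p0(2) by (simp add: U_def)
    finally show ?thesis using d by simp
  qed
  then show thesis using that fin sub by blast
qed

text \<open>At most half of \<open>\<epsilon>\<close> is the mass that \<open>\<mu>\<close> leaves
  outside a compact set \<open>K\<close> of measures, and at most half is the mass that the members
  of \<open>K\<close> leave outside their common net.\<close>

lemma avg_radon:
  assumes comp: mcomplete
  shows "radon_prob X (avg \<mu>)"
proof (rule radon_if_finite_nets[OF avg_prob avg_sets comp])
  fix \<epsilon> \<delta> :: real assume e: "\<epsilon> > 0" and d: "\<delta> > 0"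
  interpret \<mu>: prob_space \<mu> by (rule mu_prob)
  interpret q: prob_space "avg \<mu>" by (rule avg_prob)
  have sq: "space (avg \<mu>) = pts X" using sets_eq_imp_space_eq[OF avg_sets] by simp
  have "emeasure \<mu> (space \<mu>) = (SUP K\<in>{K. compactin (top_of (P_obj X)) K \<and> K \<subseteq> space \<mu>}. emeasure \<mu> K)"
    using P.P_ptsD(4)[OF \<mu>] sets.top[of \<mu>] unfolding radon_prob_def by blast
  moreover have "ennreal (1 - \<epsilon> / 2) < emeasure \<mu> (space \<mu>)"
    using ennreal_lessI[of 1 "1 - \<epsilon> / 2"] e by (simp add: \<mu>.emeasure_space_1)
  ultimately obtain K where K: "compactin (top_of (P_obj X)) K" "ennreal (1 - \<epsilon> / 2) < emeasure \<mu> K"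
    by (auto simp: less_SUP_iff)
  have "closedin (top_of (P_obj X)) K"
    using K(1) unfolding P.top_of_eq by (rule compactin_imp_closedin[OF P.Hausdorff_space_mtopology])
  then have Ks: "K \<in> sets \<mu>" using closedin_borel_on P.P_ptsD(3)[OF \<mu>] by simp
  have "1 - \<epsilon> / 2 < measure \<mu> K" using K(2) unfolding \<mu>.emeasure_eq_measure by (meson ennreal_leI not_le)
  then have Kc: "measure \<mu> (space \<mu> - K) \<le> \<epsilon> / 2" using \<mu>.prob_compl[OF Ks] by simp
  obtain N where N: "finite N" "N \<subseteq> pts X" "\<And>p. p \<in> K \<Longrightarrow> measure p (pts X - (\<Union>a\<in>N. mball a \<delta>)) \<le> \<epsilon> / 2"
    using uniform_net[OF _ d K(1), of "\<epsilon> / 2"] e half_gt_zero by blast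
  let ?B = "\<Union>a\<in>N. mball a \<delta>"
  have B: "?B \<in> sets (borel_of_omet X)" using N(1) by (intro sets.finite_UN ball_borel)
  then have cB: "pts X - ?B \<in> sets (borel_of_omet X)" using sets.compl_sets[OF B] by simp
  have "emeasure (avg \<mu>) (pts X - ?B) = (\<integral>\<^sup>+p. emeasure p (pts X - ?B) \<partial>\<mu>)"
    unfolding avg_def by (rule emeasure_bind[OF \<mu>.not_empty kernel_measurable_sub cB])
  also have "\<dots> \<le> (\<integral>\<^sup>+p. ennreal (\<epsilon> / 2) + indicator (space \<mu> - K) p \<partial>\<mu>)"
  proof (rule nn_integral_mono)
    fix p assume p: "p \<in> space \<mu>"
    then interpret prob_space p using P_ptsD(1)[of p] by (simp add: mu_space)
    show "emeasure p (pts X - ?B) \<le> ennreal (\<epsilon> / 2) + indicator (space \<mu> - K) p"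
    proof (cases "p \<in> K")
      case True
      then show ?thesis using N(3)[OF True] by (simp add: emeasure_eq_measure ennreal_leI)
    next
      case False
      have "emeasure p (pts X - ?B) \<le> 1" by (simp add: emeasure_eq_measure)
      also have "1 \<le> ennreal (\<epsilon> / 2) + indicator (space \<mu> - K) p" using False p by simp
      finally show ?thesis .
    qed
  qed
  also have "\<dots> = ennreal (\<epsilon> / 2) + emeasure \<mu> (space \<mu> - K)"
    using Ks by (subst nn_integral_add) (auto simp: \<mu>.emeasure_space_1)
  also have "\<dots> \<le> ennreal (\<epsilon> / 2) + ennreal (\<epsilon> / 2)"
    using Kc by (intro add_left_mono) (simp add: \<mu>.emeasure_eq_measure ennreal_leI)
  also have "\<dots> = ennreal \<epsilon>" using e by (simp add: ennreal_plus[symmetric] del: ennreal_plus)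
  finally have "measure (avg \<mu>) (pts X - ?B) \<le> \<epsilon>"
    using e by (simp add: q.emeasure_eq_measure)
  moreover have "measure (avg \<mu>) (pts X - ?B) = 1 - measure (avg \<mu>) ?B"
    using q.prob_compl[of ?B] B avg_sets sq by simp
  ultimately have "1 - \<epsilon> \<le> measure (avg \<mu>) ?B" by simp
  then show "\<exists>N. finite N \<and> N \<subseteq> pts X \<and> 1 - \<epsilon> \<le> measure (avg \<mu>) (\<Union>a\<in>N. mball a \<delta>)"
    using N(1,2) by blast
qed

lemma P_avg:
  assumes comp: mcomplete
  shows "P_avg X \<mu> \<in> P_pts X"
    "\<And>f. short_map X real_line f \<Longrightarrow> (\<integral>x. f x \<partial>P_avg X \<mu>) = (\<integral>p. (\<integral>x. f x \<partial>p) \<partial>\<mu>)"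
proof -
  have q: "avg \<mu> \<in> P_pts X"
    using avg_radon[OF comp] avg_integral(1) by (simp add: P_pts_def finite_first_moment_def)
  have "P_avg X \<mu> = avg \<mu>" by (rule P_avg_eqI[OF \<mu> q avg_integral(2)])
  then show "P_avg X \<mu> \<in> P_pts X"
    "\<And>f. short_map X real_line f \<Longrightarrow> (\<integral>x. f x \<partial>P_avg X \<mu>) = (\<integral>p. (\<integral>x. f x \<partial>p) \<partial>\<mu>)"
    using q avg_integral(2) by simp_all
qed

end

lemma P_avg_P_map_P_unit:
  assumes p: "p \<in> P_pts X"
  shows "P_avg X (P_map X (P_obj X) (P_unit X) p) = p"
proof -
  interpret u: short_omet X "P_obj X" "P_unit X"
    using metric_omet_P_obj[OF metric_omet_axioms] metric_omet_axioms P_unit_short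
    by (simp add: short_omet_def short_omet_axioms_def)
  show ?thesis
  proof (rule P_avg_eqI[OF u.P_map_P_pts[OF p] p])
    fix f assume f: "short_map X real_line f"
    have "(\<integral>q. (\<integral>x. f x \<partial>q) \<partial>P_map X (P_obj X) (P_unit X) p) = (\<integral>x. (\<integral>y. f y \<partial>P_unit X x) \<partial>p)"
      unfolding u.P_map_eq[OF p] by (rule u.integral_distr_short[OF p integral_functional_short[OF f]])
    also have "\<dots> = (\<integral>x. f x \<partial>p)"
      using integral_P_unit[OF _ f] P_ptsD(2)[OF p] by (intro Bochner_Integration.integral_cong) simp_all
    finally show "(\<integral>x. f x \<partial>p) = (\<integral>q. (\<integral>x. f x \<partial>q) \<partial>P_map X (P_obj X) (P_unit X) p)" by simp
  qed
qed

end

text \<open>\<open>P_map X Y f (P_avg X \<mu>)\<close> is offered as the mean of the image measure,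
  and each test function \<open>g\<close> on \<open>Y\<close> is pulled back to
  \<open>g \<circ> f\<close>, which is again short. Completeness of \<open>X\<close> makes
  \<open>P_avg X \<mu>\<close> a genuine mean.\<close>

lemma (in short_omet) P_avg_natural:
  assumes comp: "X.mcomplete" and \<mu>: "\<mu> \<in> P_pts (P_obj X)"
  shows "P_avg Y (P_map (P_obj X) (P_obj Y) (P_map X Y f) \<mu>) = P_map X Y f (P_avg X \<mu>)"
proof -
  interpret P: short_omet "P_obj X" "P_obj Y" "P_map X Y f"
    using metric_omet_P_obj[OF X.metric_omet_axioms] metric_omet_P_obj[OF Y.metric_omet_axioms] P_map_short
    by (simp add: short_omet_def short_omet_axioms_def)
  note q = X.P_avg[OF \<mu> comp]
  show ?thesis
  proof (rule Y.P_avg_eqI[OF P.P_map_P_pts[OF \<mu>] P_map_P_pts[OF q(1)]])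
    fix g assume g: "short_map Y real_line g"
    have "(\<integral>x. g x \<partial>P_map X Y f (P_avg X \<mu>)) = (\<integral>x. g (f x) \<partial>P_avg X \<mu>)"
      unfolding P_map_eq[OF q(1)] by (rule integral_distr_short[OF q(1) g])
    also have "\<dots> = (\<integral>p. (\<integral>x. g (f x) \<partial>p) \<partial>\<mu>)" by (rule q(2)[OF short_map_comp[OF short g]])
    also have "\<dots> = (\<integral>p. (\<integral>y. g y \<partial>P_map X Y f p) \<partial>\<mu>)"
    proof (rule Bochner_Integration.integral_cong[OF refl])
      fix p assume "p \<in> space \<mu>"
      then have p: "p \<in> P_pts X" by (simp add: P.X.P_ptsD(2)[OF \<mu>])
      show "(\<integral>x. g (f x) \<partial>p) = (\<integral>y. g y \<partial>P_map X Y f p)"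
        unfolding P_map_eq[OF p] by (rule integral_distr_short[OF p g, symmetric])
    qed
    also have "\<dots> = (\<integral>p. (\<integral>y. g y \<partial>p) \<partial>P_map (P_obj X) (P_obj Y) (P_map X Y f) \<mu>)"
      unfolding P.P_map_eq[OF \<mu>]
      by (rule P.integral_distr_short[OF \<mu> Y.integral_functional_short[OF g], symmetric])
    finally show "(\<integral>x. g x \<partial>P_map X Y f (P_avg X \<mu>))
        = (\<integral>p. (\<integral>y. g y \<partial>p) \<partial>P_map (P_obj X) (P_obj Y) (P_map X Y f) \<mu>)" .
  qed
qed

section \<open>The universal property\<close>

lemma monotone_map_comp:
  "monotone_map X Y f \<Longrightarrow> monotone_map Y Z g \<Longrightarrow> monotone_map X Z (\<lambda>x. g (f x))"
  unfolding monotone_map_def by blast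

text \<open>\<open>compose\<close> agrees with the composite only on the carrier, while
  \<open>monotone_map\<close> quantifies over all of \<open>leq X\<close>, so the order has to lie
  inside the square of the carrier.\<close>

lemma L_COMet_hom_composeI:
  assumes f: "short_map X Y f" "monotone_map X Y f" and g: "short_map Y Z g" "monotone_map Y Z g"
    and sub: "leq X \<subseteq> pts X \<times> pts X"
  shows "compose (pts X) g f \<in> L_COMet_hom X Z"
proof -
  have eq: "compose (pts X) g f x = g (f x)" if "x \<in> pts X" for x
    using that by (rule compose_eq)
  have s: "short_map X Z (compose (pts X) g f)"
    by (rule short_map_cong[OF short_map_comp[OF f(1) g(1)]]) (simp add: eq)
  have "monotone_map X Z (compose (pts X) g f)"
    using monotone_map_comp[OF f(2) g(2)] sub unfolding monotone_map_def by (auto simp: compose_def)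
  moreover have "compose (pts X) g f \<in> pts X \<rightarrow>\<^sub>E pts Z"
    using s by (auto simp: short_map_def compose_def PiE_def)
  ultimately show ?thesis using s by (simp add: L_COMet_hom_def)
qed

text \<open>Reflexivity and transitivity are inherited pointwise; antisymmetry gives equality on the
  carrier only, and extensionality upgrades it to equality of functions.\<close>

lemma partial_order_on_pointwise_order:
  assumes "ordered_metric_space Y" and F: "F \<subseteq> pts X \<rightarrow>\<^sub>E pts Y"
  shows "partial_order_on F (pointwise_order X Y F)"
proof -
  note O = ordered_metric_spaceD[OF assms(1)]
  have "(f, f) \<in> pointwise_order X Y F" if "f \<in> F" for f
    using that F O(4) by (auto simp: pointwise_order_def)
  moreover have "trans (pointwise_order X Y F)"
  proof (rule transI)
    fix f g h assume "(f, g) \<in> pointwise_order X Y F" "(g, h) \<in> pointwise_order X Y F"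
    then show "(f, h) \<in> pointwise_order X Y F"
      using transD[OF O(5)] unfolding pointwise_order_def by blast
  qed
  moreover have "antisym (pointwise_order X Y F)"
  proof (rule antisymI)
    fix f g assume fg: "(f, g) \<in> pointwise_order X Y F" "(g, f) \<in> pointwise_order X Y F"
    then have "f \<in> pts X \<rightarrow>\<^sub>E pts Y" "g \<in> pts X \<rightarrow>\<^sub>E pts Y"
      using F unfolding pointwise_order_def by blast+
    then show "f = g"
    proof (rule PiE_ext)
      fix x assume "x \<in> pts X"
      then have "(f x, g x) \<in> leq Y" "(g x, f x) \<in> leq Y"
        using fg unfolding pointwise_order_def by blast+
      then show "f x = g x" by (rule antisymD[OF O(6)])
    qed
  qed
  ultimately show ?thesis
    unfolding partial_order_on_def preorder_on_def refl_on_def by (auto simp: pointwise_order_def)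
qed

lemma L_COMet_homD:
  assumes "f \<in> L_COMet_hom X Y"
  shows "short_map X Y f" "monotone_map X Y f" "f \<in> pts X \<rightarrow>\<^sub>E pts Y" "f \<in> extensional (pts X)"
    "\<And>x. x \<in> pts X \<Longrightarrow> f x \<in> pts Y"
  using assms by (auto simp: L_COMet_hom_def PiE_def)

lemma P_leq_subset: "P_leq X \<subseteq> P_pts X \<times> P_pts X"
  by (auto simp: P_leq_def)

theorem mainTheorem12:
  fixes X :: "'x omet" and A :: "'a omet" and e :: "'a measure \<Rightarrow> 'a"
  assumes "L_COMet X" and "P_algebra A e"
  shows "inverse_order_isos
    (L_COMet_hom X A)
    (pointwise_order X A (L_COMet_hom X A))
    (P_algebra_hom (P_obj X) (P_avg X) A e)
    (pointwise_order (P_obj X) A (P_algebra_hom (P_obj X) (P_avg X) A e))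
    (\<lambda>f. compose (pts (P_obj X)) e (P_map X A f))
    (\<lambda>g. compose (pts X) g (P_unit X))"
proof -
  have oX: "ordered_metric_space X" and compX: "Metric_space.mcomplete (pts X) (dst X)"
    using assms(1) by (simp_all add: L_COMet_def)
  have oA: "ordered_metric_space A" and e: "e \<in> L_COMet_hom (P_obj A) A"
    and e_unit: "\<And>a. a \<in> pts A \<Longrightarrow> e (P_unit A a) = a"
    and e_avg: "\<And>\<mu>. \<mu> \<in> P_pts (P_obj A) \<Longrightarrow> e (P_avg A \<mu>) = e (P_map (P_obj A) A e \<mu>)"
    using assms(2) by (simp_all add: P_algebra_def L_COMet_def)
  note OX = ordered_metric_spaceD[OF oX] and OA = ordered_metric_spaceD[OF oA] and E = L_COMet_homD[OF e]
  interpret X: metric_omet X by (rule OX(1))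
  interpret A: metric_omet A by (rule OA(1))
  have mPX: "metric_omet (P_obj X)" and mPA: "metric_omet (P_obj A)"
    using metric_omet_P_obj OX(1) OA(1) by blast+
  let ?F = "L_COMet_hom X A" and ?G = "P_algebra_hom (P_obj X) (P_avg X) A e"
  define \<Phi> where "\<Phi> = (\<lambda>f. compose (pts (P_obj X)) e (P_map X A f))"
  define \<Psi> where "\<Psi> = (\<lambda>g :: 'x measure \<Rightarrow> 'a. compose (pts X) g (P_unit X))"
  have \<Phi>_eq: "\<Phi> f p = e (P_map X A f p)" if "p \<in> P_pts X" for f p
    using that by (simp add: \<Phi>_def compose_def)
  have \<Psi>_eq: "\<Psi> g x = g (P_unit X x)" if "x \<in> pts X" for g x
    using that by (simp add: \<Psi>_def compose_def)
  have sF: "short_omet X A f" if "f \<in> ?F" for f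
    using OX(1) OA(1) L_COMet_homD(1)[OF that] by (simp add: short_omet_def short_omet_axioms_def)

  have \<Phi>_hom: "\<Phi> f \<in> L_COMet_hom (P_obj X) A" if f: "f \<in> ?F" for f
    unfolding \<Phi>_def
    using short_omet.P_map_short[OF sF[OF f]] P_map_mono[OF oX oA L_COMet_homD(1,2)[OF f]] E(1,2) P_leq_subset
    by (intro L_COMet_hom_composeI) simp_all
  have \<Phi>: "\<Phi> f \<in> ?G" if f: "f \<in> ?F" for f
  proof -
    interpret f: short_omet X A f by (rule sF[OF f])
    interpret Pf: short_omet "P_obj X" "P_obj A" "P_map X A f"
      using mPX mPA f.P_map_short by (simp add: short_omet_def short_omet_axioms_def)
    have "\<Phi> f (P_avg X \<mu>) = e (P_map (P_obj X) A (\<Phi> f) \<mu>)" if \<mu>: "\<mu> \<in> P_pts (P_obj X)" for \<mu>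
    proof -
      have "\<Phi> f (P_avg X \<mu>) = e (P_map X A f (P_avg X \<mu>))"
        by (rule \<Phi>_eq[OF X.P_avg(1)[OF \<mu> compX]])
      also have "\<dots> = e (P_avg A (P_map (P_obj X) (P_obj A) (P_map X A f) \<mu>))"
        by (simp only: f.P_avg_natural[OF compX \<mu>])
      also have "\<dots> = e (P_map (P_obj A) A e (P_map (P_obj X) (P_obj A) (P_map X A f) \<mu>))"
        by (rule e_avg[OF Pf.P_map_P_pts[OF \<mu>]])
      \<comment> \<open>Functoriality of \<open>P_map\<close>, with \<open>\<Phi> f\<close> in the
        role of the composite because the two agree on \<open>P_pts X\<close>.\<close>
      also have "\<dots> = e (P_map (P_obj X) A (\<Phi> f) \<mu>)"
        by (subst P_map_comp[OF mPX mPA OA(1) f.P_map_short E(1) _ \<mu>]) (simp_all add: \<Phi>_eq)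
      finally show ?thesis .
    qed
    then show ?thesis using \<Phi>_hom[OF f] by (simp add: P_algebra_hom_def)
  qed
  have GD: "g \<in> L_COMet_hom (P_obj X) A" "\<And>\<mu>. \<mu> \<in> P_pts (P_obj X) \<Longrightarrow> g (P_avg X \<mu>) = e (P_map (P_obj X) A g \<mu>)"
    if "g \<in> ?G" for g
    using that by (simp_all add: P_algebra_hom_def)
  have \<Psi>: "\<Psi> g \<in> ?F" if g: "g \<in> ?G" for g
    unfolding \<Psi>_def
    by (rule L_COMet_hom_composeI[OF X.P_unit_short P_unit_mono[OF oX] L_COMet_homD(1,2)[OF GD(1)[OF g]] OX(3)])
  have \<Psi>\<Phi>: "\<Psi> (\<Phi> f) = f" if f: "f \<in> ?F" for f
  proof (rule PiE_ext[OF L_COMet_homD(3)[OF \<Psi>[OF \<Phi>[OF f]]] L_COMet_homD(3)[OF f]])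
    fix x assume x: "x \<in> pts X"
    have "\<Psi> (\<Phi> f) x = e (P_map X A f (P_unit X x))"
      by (simp add: \<Psi>_eq[OF x] \<Phi>_eq[OF X.P_unit_P_pts[OF x]])
    also have "\<dots> = e (P_unit A (f x))" by (simp only: short_omet.P_map_P_unit[OF sF[OF f] x])
    also have "\<dots> = f x" by (rule e_unit[OF L_COMet_homD(5)[OF f x]])
    finally show "\<Psi> (\<Phi> f) x = f x" .
  qed
  have \<Phi>\<Psi>: "\<Phi> (\<Psi> g) = g" if g: "g \<in> ?G" for g
  proof (rule PiE_ext[OF L_COMet_homD(3)[OF \<Phi>_hom[OF \<Psi>[OF g]]] L_COMet_homD(3)[OF GD(1)[OF g]]])
    fix p assume "p \<in> pts (P_obj X)"
    then have p: "p \<in> P_pts X" by simp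
    interpret u: short_omet X "P_obj X" "P_unit X"
      using mPX OX(1) X.P_unit_short by (simp add: short_omet_def short_omet_axioms_def)
    have "\<Phi> (\<Psi> g) p = e (P_map X A (\<Psi> g) p)" by (rule \<Phi>_eq[OF p])
    also have "\<dots> = e (P_map (P_obj X) A g (P_map X (P_obj X) (P_unit X) p))"
      by (subst P_map_comp[OF OX(1) mPX OA(1) X.P_unit_short L_COMet_homD(1)[OF GD(1)[OF g]] \<Psi>_eq[of _ g] p]) simp_all
    \<comment> \<open>The morphism property of \<open>g\<close> trades \<open>e\<close> for
      \<open>P_avg X\<close>, which leaves a unit law of the monad.\<close>
    also have "\<dots> = g (P_avg X (P_map X (P_obj X) (P_unit X) p))"
      by (rule GD(2)[OF g u.P_map_P_pts[OF p], symmetric])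
    also have "\<dots> = g p" by (simp only: X.P_avg_P_map_P_unit[OF p])
    finally show "\<Phi> (\<Psi> g) p = g p" .
  qed
  have \<Phi>_mono: "(\<Phi> f, \<Phi> f') \<in> pointwise_order (P_obj X) A ?G"
    if le: "(f, f') \<in> pointwise_order X A ?F" for f f'
  proof -
    have f: "f \<in> ?F" and f': "f' \<in> ?F" and ff': "\<And>x. x \<in> pts X \<Longrightarrow> (f x, f' x) \<in> leq A"
      using le by (auto simp: pointwise_order_def)
    have "(\<Phi> f p, \<Phi> f' p) \<in> leq A" if p: "p \<in> P_pts X" for p
      using P_map_pointwise_mono[OF OX(1) oA L_COMet_homD(1)[OF f] L_COMet_homD(1)[OF f'] ff' p] E(2)
      by (auto simp: \<Phi>_eq[OF p] monotone_map_def)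
    then show ?thesis using \<Phi>[OF f] \<Phi>[OF f'] by (simp add: pointwise_order_def)
  qed
  \<comment> \<open>The order between \<open>\<Psi> g\<close> and \<open>\<Psi> g'\<close> is the
    given comparison evaluated at Dirac measures.\<close>
  have \<Psi>_mono: "(\<Psi> g, \<Psi> g') \<in> pointwise_order X A ?F"
    if le: "(g, g') \<in> pointwise_order (P_obj X) A ?G" for g g'
    using le \<Psi> X.P_unit_P_pts by (auto simp: pointwise_order_def \<Psi>_eq)
  have "inverse_order_isos ?F (pointwise_order X A ?F) ?G (pointwise_order (P_obj X) A ?G) \<Phi> \<Psi>"
    unfolding inverse_order_isos_def
  proof (intro conjI ballI iffI)
    show "partial_order_on ?F (pointwise_order X A ?F)"
      by (rule partial_order_on_pointwise_order[OF oA]) (use L_COMet_homD(3) in blast)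
    show "partial_order_on ?G (pointwise_order (P_obj X) A ?G)"
      by (rule partial_order_on_pointwise_order[OF oA]) (use L_COMet_homD(3) GD(1) in blast)
    show "\<Phi> \<in> ?F \<rightarrow> ?G" "\<Psi> \<in> ?G \<rightarrow> ?F" using \<Phi> \<Psi> by blast+
    fix f assume f: "f \<in> ?F"
    show "\<Psi> (\<Phi> f) = f" by (rule \<Psi>\<Phi>[OF f])
    fix f' assume f': "f' \<in> ?F"
    show "(\<Phi> f, \<Phi> f') \<in> pointwise_order (P_obj X) A ?G" if "(f, f') \<in> pointwise_order X A ?F"
      by (rule \<Phi>_mono[OF that])
    \<comment> \<open>Reflection of the order is monotonicity of the inverse map.\<close>
    show "(f, f') \<in> pointwise_order X A ?F" if "(\<Phi> f, \<Phi> f') \<in> pointwise_order (P_obj X) A ?G"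
      using \<Psi>_mono[OF that] by (simp add: \<Psi>\<Phi> f f')
  next
    fix g assume g: "g \<in> ?G"
    show "\<Phi> (\<Psi> g) = g" by (rule \<Phi>\<Psi>[OF g])
    fix g' assume g': "g' \<in> ?G"
    show "(\<Psi> g, \<Psi> g') \<in> pointwise_order X A ?F" if "(g, g') \<in> pointwise_order (P_obj X) A ?G"
      by (rule \<Psi>_mono[OF that])
    show "(g, g') \<in> pointwise_order (P_obj X) A ?G" if "(\<Psi> g, \<Psi> g') \<in> pointwise_order X A ?F"
      using \<Phi>_mono[OF that] by (simp add: \<Phi>\<Psi> g g')
  qed
  then show ?thesis unfolding \<Phi>_def \<Psi>_def .
qed

end
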